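(* Let $W$ be an arbitrary Coxeter group with simple reflections indexed by $I$, and let $K\subset I$. Let $\tilde W$ be the Coxeter group obtained by gluing two copies $I^\flat,I^\sharp$ of $I$ along $K$, with the twisted Bruhat order ${}^{I^\flat}\!\!\le$. Define $$\tilde\nu:Q_K\to\tilde W,\qquad (v,w)\mapsto v^\flat (w^{-1})^\sharp.$$ Then: (1) $\tilde\nu$ induces an isomorphism of posets from $(Q_K,\preceq)$ to $(\tilde\nu(Q_K),{}^{I^\flat}\!\!\le)$; (2) $\tilde\nu(Q_K)=\{\tilde w\in\tilde W_{I^\flat}\tilde W_{I^\sharp} : r^\flat(r^{-1})^\sharp\ {}^{I^\flat}\!\!\le\ \tilde w\text{ for some } r\in W^K\}$; (3) $\tilde\nu(Q_K)$ is a convex subset of the poset $(\tilde W,{}^{I^\flat}\!\!\le)$.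
   Context: Let $\le$ be the Bruhat order on $W$; $W_K$ the subgroup generated by simple reflections in $K$; $W^K$ the set of minimal length representatives of $W/W_K$. $Q_K=\{(v,w)\in W\times W^K: v\le w\}$, with $(v',w')\preceq(v,w)$ iff there exists $u\in W_K$ with $v\le v'u\le w'u\le w$. **The group $\tilde W$.** Let $I^\flat=\{i^\flat\}$, $I^\sharp=\{i^\sharp\}$ be two copies of $I$ and $\tilde I=I^\flat\cup I^\sharp$ with $I^\flat\cap I^\sharp=\{k^\flat=k^\sharp: k\in K\}$. $\tilde W$ is the Coxeter group with simple reflections indexed by $\tilde I$ and Coxeter matrix: $\tilde m_{i^\flat,j^\flat}=\tilde m_{i^\sharp,j^\sharp}=m_{i,j}$ for $i,j\in I$ ($m$ the Coxeter matrix of $W$), and simple reflections indexed by $\tilde I-I^\flat$ commute with those indexed by $\tilde I-I^\sharp$. The parabolic subgroups $\tilde W_{I^\flat}$, $\tilde W_{I^\sharp}$ are naturally identified with $W$ via $w\mapsto w^\flat$, $w\mapsto w^\sharp$. **Twisted order.** For a Coxeter group $W$ with (real) root system $\Delta^{re}=\Delta^{re}_+\sqcup\Delta^{re}_-$ and a subset $J$ of simple reflections, let $\Delta^{re}_J$ be the root subsystem of $W_J$, $\Delta^{re}_{J,\pm}=\Delta^{re}_J\cap\Delta^{re}_\pm$, and $\Psi_J=\Delta^{re}_{J,-}\sqcup(\Delta^{re}_+-\Delta^{re}_{J,+})$. The partial order ${}^J\!\!\le$ on $W$ is generated by the relations $s_\beta w\ {}^J\!\!<\ w$ for $w\in W$,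 $\beta\in\Psi_J$ with $w^{-1}(\beta)\in\Delta^{re}_-$, where $s_\beta$ is the reflection of $\beta$. Here this is applied to $\tilde W$ and $J=I^\flat$. A subset $C$ of a poset is convex if for all $x,y\in C$ the interval $[x,y]=\{z: x\le z\le y\}$ is contained in $C$. *)

theory Defs
  imports Complex_Main "HOL-Algebra.Generated_Groups" "HOL-Library.Poly_Mapping"
begin

section \<open>Coxeter groups\<close>

record ('g, 'i) coxeter = "'g monoid" +
  simple_ix :: "'i set"
  cox_mat :: "'i \<Rightarrow> 'i \<Rightarrow> nat"
  simple_refl :: "'i \<Rightarrow> 'g"

text \<open>The entry \<open>0\<close> of a Coxeter matrix encodes \<open>\<infinity>\<close>.\<close>

definition coxeter_matrix :: "'i set \<Rightarrow> ('i \<Rightarrow> 'i \<Rightarrow> nat) \<Rightarrow> bool" where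
  "coxeter_matrix I m \<longleftrightarrow>
     (\<forall>i\<in>I. m i i = 1) \<and>
     (\<forall>i\<in>I. \<forall>j\<in>I. m i j = m j i) \<and>
     (\<forall>i\<in>I. \<forall>j\<in>I. i \<noteq> j \<longrightarrow> m i j \<noteq> 1)"

text \<open>The congruence on words over \<open>I\<close> generated by the Coxeter relations. As \<open>m i i = 1\<close>, the
  relator at \<open>(i, i)\<close> is \<open>[i, i]\<close>; hence this monoid presentation already presents the group, and
  no formal inverses are needed.\<close>

inductive cox_cong :: "'i set \<Rightarrow> ('i \<Rightarrow> 'i \<Rightarrow> nat) \<Rightarrow> 'i list \<Rightarrow> 'i list \<Rightarrow> bool"
  for I :: "'i set" and m :: "'i \<Rightarrow> 'i \<Rightarrow> nat" where
  cong_refl: "xs \<in> lists I \<Longrightarrow> cox_cong I m xs xs"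
| cong_sym: "cox_cong I m xs ys \<Longrightarrow> cox_cong I m ys xs"
| cong_trans: "cox_cong I m xs ys \<Longrightarrow> cox_cong I m ys zs \<Longrightarrow> cox_cong I m xs zs"
| cong_relator: "xs \<in> lists I \<Longrightarrow> ys \<in> lists I \<Longrightarrow> i \<in> I \<Longrightarrow> j \<in> I \<Longrightarrow> m i j \<noteq> 0 \<Longrightarrow>
    cox_cong I m (xs @ concat (replicate (m i j) [i, j]) @ ys) (xs @ ys)"

definition word_val :: "('g, 'i, 'z) coxeter_scheme \<Rightarrow> 'i list \<Rightarrow> 'g" where
  "word_val W xs = foldr (\<lambda>i g. simple_refl W i \<otimes>\<^bsub>W\<^esub> g) xs \<one>\<^bsub>W\<^esub>"

locale coxeter_system = group W for W :: "('g, 'i, 'z) coxeter_scheme" (structure) +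
  assumes matrix: "coxeter_matrix (simple_ix W) (cox_mat W)"
    and simple_closed: "simple_refl W \<in> simple_ix W \<rightarrow> carrier W"
    and generated: "carrier W = generate W (simple_refl W ` simple_ix W)"
    and presented: "xs \<in> lists (simple_ix W) \<Longrightarrow> ys \<in> lists (simple_ix W) \<Longrightarrow>
      word_val W xs = word_val W ys \<longleftrightarrow> cox_cong (simple_ix W) (cox_mat W) xs ys"

definition cox_len :: "('g, 'i, 'z) coxeter_scheme \<Rightarrow> 'g \<Rightarrow> nat" where
  "cox_len W w = (LEAST n. \<exists>xs\<in>lists (simple_ix W). word_val W xs = w \<and> length xs = n)"

definition cox_reflections :: "('g, 'i, 'z) coxeter_scheme \<Rightarrow> 'g set" where
  "cox_reflections W =
     {w \<otimes>\<^bsub>W\<^esub> simple_refl W i \<otimes>\<^bsub>W\<^esub> inv\<^bsub>W\<^esub> w | w i. w \<in> carrier W \<and> i \<in> simple_ix W}"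

definition bruhat_le :: "('g, 'i, 'z) coxeter_scheme \<Rightarrow> 'g \<Rightarrow> 'g \<Rightarrow> bool" where
  "bruhat_le W x y \<longleftrightarrow> x \<in> carrier W \<and> y \<in> carrier W \<and>
     (\<lambda>u v. u \<in> carrier W \<and> (\<exists>t\<in>cox_reflections W. v = t \<otimes>\<^bsub>W\<^esub> u) \<and>
        cox_len W u < cox_len W v)\<^sup>*\<^sup>* x y"

definition parabolic :: "('g, 'i, 'z) coxeter_scheme \<Rightarrow> 'i set \<Rightarrow> 'g set" where
  "parabolic W J = generate W (simple_refl W ` J)"

definition min_reps :: "('g, 'i, 'z) coxeter_scheme \<Rightarrow> 'i set \<Rightarrow> 'g set" where
  "min_reps W J =
     {w \<in> carrier W. \<forall>u\<in>parabolic W J. cox_len W w \<le> cox_len W (w \<otimes>\<^bsub>W\<^esub> u)}"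

section \<open>Geometric representation, roots and twisted orders\<close>

text \<open>The underlying space consists of the finitely supported functions on the indices;
  \<open>Poly_Mapping.single i 1\<close> is the simple root of index \<open>i\<close>.\<close>

definition cox_form :: "('g, 'i, 'z) coxeter_scheme \<Rightarrow> ('i \<Rightarrow>\<^sub>0 real) \<Rightarrow> ('i \<Rightarrow>\<^sub>0 real) \<Rightarrow> real" where
  "cox_form W x y =
     (\<Sum>i\<in>Poly_Mapping.keys x. \<Sum>j\<in>Poly_Mapping.keys y.
        Poly_Mapping.lookup x i * Poly_Mapping.lookup y j *
        (if cox_mat W i j = 0 then - 1 else - cos (pi / real (cox_mat W i j))))"

definition geom_refl :: "('g, 'i, 'z) coxeter_scheme \<Rightarrow> 'i \<Rightarrow> ('i \<Rightarrow>\<^sub>0 real) \<Rightarrow> ('i \<Rightarrow>\<^sub>0 real)" where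
  "geom_refl W i x =
     x - Poly_Mapping.single i (2 * cox_form W (Poly_Mapping.single i 1) x)"

text \<open>By the Coxeter relations, the vector described does not depend on the word for \<open>w\<close>.\<close>

definition geom_act :: "('g, 'i, 'z) coxeter_scheme \<Rightarrow> 'g \<Rightarrow> ('i \<Rightarrow>\<^sub>0 real) \<Rightarrow> ('i \<Rightarrow>\<^sub>0 real)" where
  "geom_act W w x =
     (THE y. \<exists>xs\<in>lists (simple_ix W). word_val W xs = w \<and> y = foldr (geom_refl W) xs x)"

definition roots_of :: "('g, 'i, 'z) coxeter_scheme \<Rightarrow> 'i set \<Rightarrow> ('i \<Rightarrow>\<^sub>0 real) set" where
  "roots_of W J = {geom_act W w (Poly_Mapping.single j 1) | w j. w \<in> parabolic W J \<and> j \<in> J}"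

abbreviation real_roots :: "('g, 'i, 'z) coxeter_scheme \<Rightarrow> ('i \<Rightarrow>\<^sub>0 real) set" where
  "real_roots W \<equiv> roots_of W (simple_ix W)"

definition pos_roots :: "('g, 'i, 'z) coxeter_scheme \<Rightarrow> ('i \<Rightarrow>\<^sub>0 real) set" where
  "pos_roots W = {\<beta> \<in> real_roots W. \<forall>i. 0 \<le> Poly_Mapping.lookup \<beta> i}"

definition neg_roots :: "('g, 'i, 'z) coxeter_scheme \<Rightarrow> ('i \<Rightarrow>\<^sub>0 real) set" where
  "neg_roots W = {\<beta> \<in> real_roots W. \<forall>i. Poly_Mapping.lookup \<beta> i \<le> 0}"

text \<open>The group element acting on the geometric representation as the reflection in \<open>\<beta>\<close>.\<close>

definition root_refl :: "('g, 'i, 'z) coxeter_scheme \<Rightarrow> ('i \<Rightarrow>\<^sub>0 real) \<Rightarrow> 'g" where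
  "root_refl W \<beta> = (THE t. \<exists>w\<in>carrier W. \<exists>i\<in>simple_ix W.
     \<beta> = geom_act W w (Poly_Mapping.single i 1) \<and>
     t = w \<otimes>\<^bsub>W\<^esub> simple_refl W i \<otimes>\<^bsub>W\<^esub> inv\<^bsub>W\<^esub> w)"

definition twisted_pos :: "('g, 'i, 'z) coxeter_scheme \<Rightarrow> 'i set \<Rightarrow> ('i \<Rightarrow>\<^sub>0 real) set" where
  "twisted_pos W J =
     (roots_of W J \<inter> neg_roots W) \<union> (pos_roots W - (roots_of W J \<inter> pos_roots W))"

definition twisted_le :: "('g, 'i, 'z) coxeter_scheme \<Rightarrow> 'i set \<Rightarrow> 'g \<Rightarrow> 'g \<Rightarrow> bool" where
  "twisted_le W J x y \<longleftrightarrow> x \<in> carrier W \<and> y \<in> carrier W \<and>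
     (\<lambda>u w. w \<in> carrier W \<and> (\<exists>\<beta>\<in>twisted_pos W J.
        geom_act W (inv\<^bsub>W\<^esub> w) \<beta> \<in> neg_roots W \<and> u = root_refl W \<beta> \<otimes>\<^bsub>W\<^esub> w))\<^sup>*\<^sup>* x y"

section \<open>Gluing two copies along a subset of the simple reflections\<close>

text \<open>\<open>Inl i\<close> is the index \<open>i\<^sup>\<flat>\<close>. The index \<open>i\<^sup>\<sharp>\<close> is \<open>Inl i\<close> (hence equal to \<open>i\<^sup>\<flat>\<close>) for \<open>i \<in> K\<close> and
  \<open>Inr i\<close> otherwise.\<close>

definition flat_ix :: "'i \<Rightarrow> 'i + 'i" where
  "flat_ix i = Inl i"

definition sharp_ix :: "'i set \<Rightarrow> 'i \<Rightarrow> 'i + 'i" where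
  "sharp_ix K i = (if i \<in> K then Inl i else Inr i)"

definition glued_system ::
  "('g, 'i, 'y) coxeter_scheme \<Rightarrow> 'i set \<Rightarrow> ('h, 'i + 'i, 'z) coxeter_scheme \<Rightarrow> bool" where
  "glued_system W K V \<longleftrightarrow> coxeter_system V \<and>
     (let I = simple_ix W; m = cox_mat W; m' = cox_mat V;
          Iflat = flat_ix ` I; Isharp = sharp_ix K ` I
      in simple_ix V = Iflat \<union> Isharp \<and>
         (\<forall>i\<in>I. \<forall>j\<in>I. m' (flat_ix i) (flat_ix j) = m i j) \<and>
         (\<forall>i\<in>I. \<forall>j\<in>I. m' (sharp_ix K i) (sharp_ix K j) = m i j) \<and>
         (\<forall>a\<in>simple_ix V - Iflat. \<forall>b\<in>simple_ix V - Isharp. m' a b = 2))"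

text \<open>The group homomorphism induced by a map of simple reflections compatible with the Coxeter
  matrices; it is computed on words.\<close>

definition induced_map ::
  "('g, 'i, 'y) coxeter_scheme \<Rightarrow> ('h, 'j, 'z) coxeter_scheme \<Rightarrow> ('i \<Rightarrow> 'j) \<Rightarrow> 'g \<Rightarrow> 'h" where
  "induced_map W V f w =
     (THE g. \<exists>xs\<in>lists (simple_ix W). word_val W xs = w \<and> g = word_val V (map f xs))"

definition flat_map ::
  "('g, 'i, 'y) coxeter_scheme \<Rightarrow> ('h, 'i + 'i, 'z) coxeter_scheme \<Rightarrow> 'g \<Rightarrow> 'h" where
  "flat_map W V = induced_map W V flat_ix"

definition sharp_map ::
  "('g, 'i, 'y) coxeter_scheme \<Rightarrow> 'i set \<Rightarrow> ('h, 'i + 'i, 'z) coxeter_scheme \<Rightarrow> 'g \<Rightarrow> 'h" where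
  "sharp_map W K V = induced_map W V (sharp_ix K)"

section \<open>The poset \<open>Q\<^sub>K\<close> and the map into the glued group\<close>

definition Q_set :: "('g, 'i, 'z) coxeter_scheme \<Rightarrow> 'i set \<Rightarrow> ('g \<times> 'g) set" where
  "Q_set W K = {(v, w). v \<in> carrier W \<and> w \<in> min_reps W K \<and> bruhat_le W v w}"

definition Q_le :: "('g, 'i, 'z) coxeter_scheme \<Rightarrow> 'i set \<Rightarrow> 'g \<times> 'g \<Rightarrow> 'g \<times> 'g \<Rightarrow> bool" where
  "Q_le W K = (\<lambda>(v', w') (v, w). \<exists>u\<in>parabolic W K.
     bruhat_le W v (v' \<otimes>\<^bsub>W\<^esub> u) \<and> bruhat_le W (v' \<otimes>\<^bsub>W\<^esub> u) (w' \<otimes>\<^bsub>W\<^esub> u) \<and>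
     bruhat_le W (w' \<otimes>\<^bsub>W\<^esub> u) w)"

definition nu_map ::
  "('g, 'i, 'y) coxeter_scheme \<Rightarrow> 'i set \<Rightarrow> ('h, 'i + 'i, 'z) coxeter_scheme \<Rightarrow> 'g \<times> 'g \<Rightarrow> 'h" where
  "nu_map W K V = (\<lambda>(v, w). flat_map W V v \<otimes>\<^bsub>V\<^esub> sharp_map W K V (inv\<^bsub>W\<^esub> w))"

section \<open>Posets given by a carrier set and a relation\<close>

definition poset_on :: "'a set \<Rightarrow> ('a \<Rightarrow> 'a \<Rightarrow> bool) \<Rightarrow> bool" where
  "poset_on A ord \<longleftrightarrow> reflp_on A ord \<and> transp_on A ord \<and> antisymp_on A ord"

definition poset_iso ::
  "'a set \<Rightarrow> ('a \<Rightarrow> 'a \<Rightarrow> bool) \<Rightarrow> 'b set \<Rightarrow> ('b \<Rightarrow> 'b \<Rightarrow> bool) \<Rightarrow> ('a \<Rightarrow> 'b) \<Rightarrow> bool" where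
  "poset_iso A ordA B ordB f \<longleftrightarrow> poset_on A ordA \<and> poset_on B ordB \<and> bij_betw f A B \<and>
     (\<forall>x\<in>A. \<forall>y\<in>A. ordA x y \<longleftrightarrow> ordB (f x) (f y))"

definition poset_convex :: "'a set \<Rightarrow> ('a \<Rightarrow> 'a \<Rightarrow> bool) \<Rightarrow> 'a set \<Rightarrow> bool" where
  "poset_convex P ord C \<longleftrightarrow> poset_on P ord \<and> C \<subseteq> P \<and>
     (\<forall>x\<in>C. \<forall>y\<in>C. {z \<in> P. ord x z \<and> ord z y} \<subseteq> C)"

end

theory Submission
  imports Defs
begin

text \<open>Let \<open>J = I\<^sup>\<flat>\<close>. Every element of \<open>V\<close> is uniquely a product \<open>a b\<close> with \<open>a \<in> V\<^sub>J\<close> and \<open>b\<close> of minimal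
  length in \<open>V\<^sub>J b\<close>. A step down from \<open>a b\<close> in the twisted order either raises \<open>a\<close> in the Bruhat order
  of \<open>V\<^sub>J\<close> or replaces \<open>b\<close> by \<open>t b < b\<close>. If \<open>b\<close> lies in the sharp parabolic subgroup then so do \<open>t\<close> and
  \<open>t b\<close>; hence \<open>V\<^sub>\<flat> V\<^sub>\<sharp>\<close> is a lower set, on which everything can be expressed in \<open>W\<close>: below
  \<open>v\<^sup>\<flat> (w\<inverse>)\<^sup>\<sharp>\<close> lie exactly the \<open>v'\<^sup>\<flat> (w'\<inverse>)\<^sup>\<sharp>\<close> such that \<open>v \<le> v' u\<close> and \<open>w' u \<le> w\<close> for some \<open>u \<in> W\<^sub>K\<close>.
  All three claims follow from this, because \<open>v' \<le> w'\<close> with \<open>w'\<close> minimal in \<open>w' W\<^sub>K\<close> implies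
  \<open>v' u \<le> w' u\<close>. The twisted order is antisymmetric because the pair of the length of \<open>b\<close> and the
  negated length of \<open>a\<close> increases lexicographically along it.

  The signs of roots enter only through lengths: a root \<open>w \<alpha>\<^sub>i\<close> is positive iff \<open>w s\<^sub>i > w\<close>. This also
  shows that the two embeddings of \<open>W\<close> into \<open>V\<close> preserve length, since the geometric
  representation of \<open>W\<close> is a restriction of that of \<open>V\<close>.\<close>

section \<open>Words and length\<close>

context coxeter_system
begin

abbreviation "ix \<equiv> simple_ix W"
abbreviation "s \<equiv> simple_refl W"
abbreviation "val \<equiv> word_val W"
abbreviation "len \<equiv> cox_len W"
abbreviation "refls \<equiv> cox_reflections W"

lemma s_closed [simp]: "i \<in> ix \<Longrightarrow> s i \<in> carrier W"
  using simple_closed by auto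

lemma val_Nil [simp]: "val [] = \<one>"
  by (simp add: word_val_def)

lemma val_Cons [simp]: "val (i # xs) = s i \<otimes> val xs"
  by (simp add: word_val_def)

lemma val_closed [simp]: "xs \<in> lists ix \<Longrightarrow> val xs \<in> carrier W"
  by (induction xs) auto

lemma val_append: "xs \<in> lists ix \<Longrightarrow> ys \<in> lists ix \<Longrightarrow> val (xs @ ys) = val xs \<otimes> val ys"
  by (induction xs) (auto simp: m_assoc)

lemma cox_mat_same: "i \<in> ix \<Longrightarrow> cox_mat W i i = 1"
  using matrix by (auto simp: coxeter_matrix_def)

lemma cox_mat_sym: "i \<in> ix \<Longrightarrow> j \<in> ix \<Longrightarrow> cox_mat W i j = cox_mat W j i"
  using matrix by (auto simp: coxeter_matrix_def)

lemma cox_mat_neq_1: "i \<in> ix \<Longrightarrow> j \<in> ix \<Longrightarrow> i \<noteq> j \<Longrightarrow> cox_mat W i j \<noteq> 1"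
  using matrix by (auto simp: coxeter_matrix_def)

lemma s_sq [simp]: assumes "i \<in> ix" shows "s i \<otimes> s i = \<one>"
proof -
  have "cox_cong ix (cox_mat W) ([] @ concat (replicate (cox_mat W i i) [i, i]) @ []) ([] @ [])"
    using assms by (intro cong_relator) (auto simp: cox_mat_same)
  then have "val [i, i] = val []"
    using assms by (subst presented) (auto simp: cox_mat_same)
  then show ?thesis using assms by simp
qed

lemma inv_s [simp]: "i \<in> ix \<Longrightarrow> inv (s i) = s i"
  by (simp add: inv_equality)

lemma s_cancel_left [simp]: "i \<in> ix \<Longrightarrow> x \<in> carrier W \<Longrightarrow> s i \<otimes> (s i \<otimes> x) = x"
  by (metis l_one m_assoc s_closed s_sq)

lemma s_cancel_right [simp]: "i \<in> ix \<Longrightarrow> x \<in> carrier W \<Longrightarrow> x \<otimes> s i \<otimes> s i = x"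
  by (simp add: m_assoc)

lemma inv_val: "xs \<in> lists ix \<Longrightarrow> inv (val xs) = val (rev xs)"
  by (induction xs) (auto simp: inv_mult_group val_append in_lists_conv_set)

text \<open>Simple reflections are involutions, so inverse generators are again letters and words
  without formal inverses suffice.\<close>

lemma parabolic_words:
  assumes "J \<subseteq> ix"
  shows "parabolic W J = val ` lists J"
proof (intro equalityI subsetI)
  have lJ: "xs \<in> lists ix" if "xs \<in> lists J" for xs using that assms by auto
  fix w assume "w \<in> parabolic W J"
  then have "w \<in> generate W (s ` J)" by (simp add: parabolic_def)
  then show "w \<in> val ` lists J"
  proof induction
    case one
    then show ?case by (intro image_eqI[of _ _ "[]"]) auto
  next
    case (incl h)
    then obtain j where "j \<in> J" "h = s j" by auto
    then show ?case using assms by (intro image_eqI[of _ _ "[j]"]) auto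
  next
    case (inv h)
    then obtain j where "j \<in> J" "h = s j" by auto
    then show ?case using assms by (intro image_eqI[of _ _ "[j]"]) (auto simp: subset_iff)
  next
    case (eng h1 h2)
    then obtain xs ys where "xs \<in> lists J" "ys \<in> lists J" "h1 = val xs" "h2 = val ys" by auto
    then show ?case using lJ by (intro image_eqI[of _ _ "xs @ ys"]) (auto simp: val_append)
  qed
next
  fix w assume "w \<in> val ` lists J"
  then obtain xs where "xs \<in> lists J" "w = val xs" by auto
  moreover have "xs \<in> lists J \<Longrightarrow> val xs \<in> generate W (s ` J)"
    by (induction xs) (auto intro: generate.intros)
  ultimately show "w \<in> parabolic W J" by (simp add: parabolic_def)
qed

lemma carrier_words: "carrier W = val ` lists ix"
  using parabolic_words[of ix] generated by (simp add: parabolic_def)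

lemma word_cases:
  assumes "w \<in> carrier W"
  obtains xs where "xs \<in> lists ix" "w = val xs"
  using assms carrier_words by blast

lemma parabolic_subgroup: "J \<subseteq> ix \<Longrightarrow> subgroup (parabolic W J) W"
  unfolding parabolic_def by (intro generate_is_subgroup) auto

lemma reduced_word:
  assumes "w \<in> carrier W"
  obtains xs where "xs \<in> lists ix" "val xs = w" "length xs = len w"
proof -
  have "\<exists>n. \<exists>xs\<in>lists ix. val xs = w \<and> length xs = n"
    using assms carrier_words by auto
  then have "\<exists>xs\<in>lists ix. val xs = w \<and> length xs = len w"
    unfolding cox_len_def by (rule LeastI_ex)
  then show ?thesis using that by blast
qed

lemma len_val_le: "xs \<in> lists ix \<Longrightarrow> len (val xs) \<le> length xs"
  unfolding cox_len_def by (rule Least_le) auto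

lemma len_one [simp]: "len \<one> = 0"
  using len_val_le[of "[]"] by simp

lemma len_eq_0: "w \<in> carrier W \<Longrightarrow> len w = 0 \<longleftrightarrow> w = \<one>"
  by (metis reduced_word length_0_conv val_Nil len_one)

lemma len_mult: "x \<in> carrier W \<Longrightarrow> y \<in> carrier W \<Longrightarrow> len (x \<otimes> y) \<le> len x + len y"
  by (metis reduced_word len_val_le val_append length_append append_in_lists_conv)

lemma len_inv_le: "x \<in> carrier W \<Longrightarrow> len (inv x) \<le> len x"
  by (metis reduced_word len_val_le inv_val length_rev in_lists_conv_set set_rev)

lemma len_inv [simp]: "x \<in> carrier W \<Longrightarrow> len (inv x) = len x"
  by (metis len_inv_le inv_inv inv_closed le_antisym)

lemma len_s_le: "i \<in> ix \<Longrightarrow> len (s i) \<le> 1"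
  using len_val_le[of "[i]"] by simp

text \<open>The letter is the last one of a reduced word. Several inductions on length below peel
  off letters in this way.\<close>

lemma last_letter:
  assumes "w \<in> carrier W" "w \<noteq> \<one>"
  obtains i where "i \<in> ix" "len w = Suc (len (w \<otimes> s i))"
proof -
  obtain xs where xs: "xs \<in> lists ix" "val xs = w" "length xs = len w"
    using assms(1) reduced_word by blast
  then obtain ys i where ys: "xs = ys @ [i]"
    using assms by (metis rev_exhaust val_Nil)
  then have i: "i \<in> ix" and w: "w = val ys \<otimes> s i" using xs by (auto simp: val_append)
  have "w \<otimes> s i = val ys" using i w xs(1) ys by simp
  then have "len (w \<otimes> s i) \<le> length ys" using len_val_le xs(1) ys by auto
  moreover have "len w \<le> len (w \<otimes> s i) + 1"
    using len_mult[of "w \<otimes> s i" "s i"] len_s_le[OF i] i assms(1) by simp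
  ultimately show ?thesis using that[of i] i xs(3) ys by simp
qed

end

section \<open>Alternating words and the braid relation\<close>

text \<open>The recursion adds letters on the left, so parity decides which one comes next; the last
  letter of a nonempty word is always \<open>j\<close>.\<close>

fun alt :: "'a \<Rightarrow> 'a \<Rightarrow> nat \<Rightarrow> 'a list" where
  "alt i j 0 = []"
| "alt i j (Suc k) = (if even k then j else i) # alt i j k"

lemma length_alt [simp]: "length (alt i j k) = k"
  by (induction k) auto

lemma alt_in_lists: "i \<in> A \<Longrightarrow> j \<in> A \<Longrightarrow> alt i j k \<in> lists A"
  by (induction k) auto

lemma alt_add: "alt i j (a + b) = (if even b then alt i j a else alt j i a) @ alt i j b"
  by (induction a) auto

lemma alt_Suc_right: "alt i j (Suc k) = alt j i k @ [j]"
  using alt_add[of i j k 1] by simp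

lemma rev_alt: "rev (alt i j k) = (if even k then alt j i k else alt i j k)"
proof (induction k arbitrary: i j)
  case (Suc k)
  have "rev (alt i j (Suc k)) = j # rev (alt j i k)"
    unfolding alt_Suc_right by simp
  then show ?case using Suc[of j i] by simp
qed simp

lemma concat_replicate_alt: "concat (replicate m [i, j]) = alt i j (2 * m)"
  by (induction m) auto

context coxeter_system
begin

text \<open>Cut the relator, which has length \<open>2 m\<close>, in the middle. One half is the
  inverse of the other, and reversing the left half \<open>F\<close> gives the alternating word with
  \<open>i\<close> and \<open>j\<close> exchanged.\<close>

lemma braid:
  assumes "i \<in> ix" "j \<in> ix" "cox_mat W i j \<noteq> 0"
  shows "val (alt i j (cox_mat W i j)) = val (alt j i (cox_mat W i j))"
proof -
  define m where "m = cox_mat W i j"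
  define F where "F = (if even m then alt i j m else alt j i m)"
  have lists: "alt i j k \<in> lists ix" "alt j i k \<in> lists ix" for k
    using assms alt_in_lists by fast+
  have "cox_cong ix (cox_mat W) ([] @ concat (replicate m [i, j]) @ []) ([] @ [])"
    unfolding m_def using assms by (intro cong_relator) auto
  then have "val (alt i j (m + m)) = \<one>"
    using presented[of "alt i j (m + m)" "[]"] lists by (simp add: concat_replicate_alt mult_2)
  then have "val F \<otimes> val (alt i j m) = \<one>"
    unfolding alt_add F_def using lists by (auto simp: val_append)
  moreover have F: "F \<in> lists ix" using lists by (simp add: F_def)
  ultimately have "val (alt i j m) = inv (val F)"
    using lists by (metis inv_equality inv_inv val_closed)
  also have "\<dots> = val (alt j i m)"
    using F by (subst inv_val) (auto simp: F_def rev_alt)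
  finally show ?thesis by (simp add: m_def)
qed

end

section \<open>The geometric representation\<close>

abbreviation "keys \<equiv> Poly_Mapping.keys"
abbreviation "lookup \<equiv> Poly_Mapping.lookup"

definition scl :: "real \<Rightarrow> ('a \<Rightarrow>\<^sub>0 real) \<Rightarrow> ('a \<Rightarrow>\<^sub>0 real)" where
  "scl c x = Poly_Mapping.map ((*) c) x"

abbreviation basis_vec :: "'a \<Rightarrow> ('a \<Rightarrow>\<^sub>0 real)" where
  "basis_vec i \<equiv> Poly_Mapping.single i 1"

lemma lookup_scl [simp]: "lookup (scl c x) k = c * lookup x k"
  by (simp add: scl_def Poly_Mapping.map.rep_eq when_def)

lemma keys_scl: "keys (scl c x) \<subseteq> keys x"
  by (auto simp: in_keys_iff)

lemma scl_simps [simp]: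
  "scl 0 x = 0" "scl 1 x = x" "scl c 0 = 0" "scl (- c) x = - scl c x"
  "scl a (scl b x) = scl (a * b) x"
  by (auto intro!: poly_mapping_eqI)

lemma scl_diff: "scl c (x - y) = scl c x - scl c y"
  by (intro poly_mapping_eqI) (simp add: lookup_minus algebra_simps)

lemma scl_uminus: "scl c (- x) = - scl c x"
  by (intro poly_mapping_eqI) simp

lemma scl_add_left: "scl (a + b) x = scl a x + scl b x"
  by (intro poly_mapping_eqI) (simp add: lookup_add algebra_simps)

lemma single_conv_scl: "Poly_Mapping.single i c = scl c (basis_vec i)"
  by (intro poly_mapping_eqI) (simp add: lookup_single when_def)

definition cox_coeff :: "('g, 'i, 'z) coxeter_scheme \<Rightarrow> 'i \<Rightarrow> 'i \<Rightarrow> real" where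
  "cox_coeff W i j = (if cox_mat W i j = 0 then - 1 else - cos (pi / real (cox_mat W i j)))"

text \<open>The form is summed over supports, which change under addition and scaling. Padding with
  zeros to common finite index sets makes bilinearity a manipulation of finite sums.\<close>

lemma cox_form_superset:
  assumes "finite S" "finite T" "keys x \<subseteq> S" "keys y \<subseteq> T"
  shows "cox_form W x y = (\<Sum>i\<in>S. \<Sum>j\<in>T. lookup x i * lookup y j * cox_coeff W i j)"
proof -
  have "cox_form W x y =
      (\<Sum>i\<in>keys x. \<Sum>j\<in>keys y. lookup x i * lookup y j * cox_coeff W i j)"
    by (simp add: cox_form_def cox_coeff_def)
  also have "\<dots> = (\<Sum>i\<in>keys x. \<Sum>j\<in>T. lookup x i * lookup y j * cox_coeff W i j)"
    using assms by (intro sum.cong sum.mono_neutral_left) (auto simp: in_keys_iff)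
  also have "\<dots> = (\<Sum>i\<in>S. \<Sum>j\<in>T. lookup x i * lookup y j * cox_coeff W i j)"
    using assms by (intro sum.mono_neutral_left) (auto simp: in_keys_iff)
  finally show ?thesis .
qed

lemma cox_form_add_left: "cox_form W (x + y) z = cox_form W x z + cox_form W y z"
  using keys_add[of x y]
  by (subst (1 2 3) cox_form_superset[of "keys x \<union> keys y" "keys z"])
     (auto simp: lookup_add distrib_right sum.distrib)

lemma cox_form_add_right: "cox_form W z (x + y) = cox_form W z x + cox_form W z y"
  using keys_add[of x y]
  by (subst (1 2 3) cox_form_superset[of "keys z" "keys x \<union> keys y"])
     (auto simp: lookup_add distrib_left distrib_right sum.distrib)

lemma cox_form_scl_left: "cox_form W (scl c x) z = c * cox_form W x z"
  using keys_scl[of c x]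
  by (subst (1 2) cox_form_superset[of "keys x" "keys z"])
     (auto simp: sum_distrib_left mult_ac)

lemma cox_form_scl_right: "cox_form W z (scl c x) = c * cox_form W z x"
  using keys_scl[of c x]
  by (subst (1 2) cox_form_superset[of "keys z" "keys x"])
     (auto simp: sum_distrib_left mult_ac)

lemma cox_form_uminus_left: "cox_form W (- x) z = - cox_form W x z"
  using cox_form_scl_left[of W "-1" x z] by simp

lemma cox_form_uminus_right: "cox_form W z (- x) = - cox_form W z x"
  using cox_form_scl_right[of W z "-1" x] by simp

lemma cox_form_diff_left: "cox_form W (x - y) z = cox_form W x z - cox_form W y z"
  using cox_form_add_left[of W x "-y" z] by (simp add: cox_form_uminus_left)

lemma cox_form_diff_right: "cox_form W z (x - y) = cox_form W z x - cox_form W z y"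
  using cox_form_add_right[of W z x "-y"] by (simp add: cox_form_uminus_right)

lemmas cox_form_linear =
  cox_form_add_left cox_form_add_right cox_form_diff_left cox_form_diff_right
  cox_form_uminus_left cox_form_uminus_right cox_form_scl_left cox_form_scl_right

lemma cox_form_basis: "cox_form W (basis_vec i) (basis_vec j) = cox_coeff W i j"
  by (subst cox_form_superset[of "{i}" "{j}"]) auto

lemma geom_refl_conv: "geom_refl W i x = x - scl (2 * cox_form W (basis_vec i) x) (basis_vec i)"
  by (simp add: geom_refl_def single_conv_scl[symmetric])

lemma geom_refl_add: "geom_refl W i (x + y) = geom_refl W i x + geom_refl W i y"
  by (simp add: geom_refl_conv cox_form_linear distrib_left scl_add_left)

lemma geom_refl_scl: "geom_refl W i (scl c x) = scl c (geom_refl W i x)"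
  by (simp add: geom_refl_conv cox_form_linear scl_diff mult_ac)

abbreviation word_act :: "('g, 'i, 'z) coxeter_scheme \<Rightarrow> 'i list \<Rightarrow> ('i \<Rightarrow>\<^sub>0 real) \<Rightarrow> ('i \<Rightarrow>\<^sub>0 real)" where
  "word_act W xs x \<equiv> foldr (geom_refl W) xs x"

lemma word_act_add: "word_act W xs (x + y) = word_act W xs x + word_act W xs y"
  by (induction xs) (auto simp: geom_refl_add)

lemma word_act_scl: "word_act W xs (scl c x) = scl c (word_act W xs x)"
  by (induction xs) (auto simp: geom_refl_scl)

lemma word_act_uminus: "word_act W xs (- x) = - word_act W xs x"
  using word_act_scl[of W xs "-1" x] by simp

lemma word_act_fixed:
  "\<forall>i\<in>set xs. cox_form W (basis_vec i) x = 0 \<Longrightarrow> word_act W xs x = x"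
  by (induction xs) (auto simp: geom_refl_conv)

section \<open>Rank two: Chebyshev values and the Coxeter relations\<close>

fun cheb :: "real \<Rightarrow> nat \<Rightarrow> real" where
  "cheb q 0 = 0"
| "cheb q (Suc 0) = 1"
| "cheb q (Suc (Suc k)) = q * cheb q (Suc k) - cheb q k"

text \<open>This is the case of an infinite bond: there the form takes the value -1 on the two
  simple roots, which gives \<open>q = 2\<close>.\<close>

lemma cheb_two: "cheb 2 k = real k"
  by (induction k rule: induct_nat_012) auto

text \<open>Multiplied by \<open>sin \<theta>\<close>, the recurrence of \<open>cheb\<close> becomes
  the addition formula for \<open>sin ((k + 2) \<theta>) + sin (k \<theta>)\<close>.\<close>

lemma cheb_cos: "cheb (2 * cos \<theta>) k * sin \<theta> = sin (real k * \<theta>)"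
proof (induction k rule: induct_nat_012)
  case (ge2 k)
  have "sin (real (Suc (Suc k)) * \<theta>) + sin (real k * \<theta>) =
      2 * cos \<theta> * sin (real (Suc k) * \<theta>)"
  proof -
    have "real (Suc (Suc k)) * \<theta> = real (Suc k) * \<theta> + \<theta>" "real k * \<theta> = real (Suc k) * \<theta> - \<theta>"
      by (auto simp: algebra_simps)
    then show ?thesis by (simp only: sin_add sin_diff) (simp add: algebra_simps)
  qed
  then have "sin (real (Suc (Suc k)) * \<theta>) =
      2 * cos \<theta> * sin (real (Suc k) * \<theta>) - sin (real k * \<theta>)" by linarith
  moreover have "cheb (2 * cos \<theta>) (Suc (Suc k)) * sin \<theta> =
      2 * cos \<theta> * (cheb (2 * cos \<theta>) (Suc k) * sin \<theta>) - cheb (2 * cos \<theta>) k * sin \<theta>"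
    by (simp add: algebra_simps)
  ultimately show ?case using ge2 by simp
qed auto

context coxeter_system
begin

abbreviation "B \<equiv> cox_form W"

lemma cox_coeff_same: "i \<in> ix \<Longrightarrow> cox_coeff W i i = 1"
  by (simp add: cox_coeff_def cox_mat_same)

lemma cox_coeff_sym: "i \<in> ix \<Longrightarrow> j \<in> ix \<Longrightarrow> cox_coeff W i j = cox_coeff W j i"
  by (simp add: cox_coeff_def cox_mat_sym)

lemma geom_refl_invol: "i \<in> ix \<Longrightarrow> geom_refl W i (geom_refl W i x) = x"
  by (simp add: geom_refl_conv cox_form_linear cox_form_basis cox_coeff_same)

lemma geom_refl_basis:
  "geom_refl W i (basis_vec j) = basis_vec j + scl (- 2 * cox_coeff W i j) (basis_vec i)"
  by (simp add: geom_refl_conv cox_form_basis)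

lemma geom_refl_basis_same: "i \<in> ix \<Longrightarrow> geom_refl W i (basis_vec i) = - basis_vec i"
  by (intro poly_mapping_eqI)
     (simp add: geom_refl_basis cox_coeff_same lookup_add lookup_minus lookup_single when_def)

text \<open>Each of the two reflections changes only its own coefficient, and does so by the
  recurrence of \<open>cheb\<close>. Parity tells which coefficient was updated last.\<close>

lemma word_act_alt:
  assumes "i \<in> ix" "j \<in> ix"
  defines "p \<equiv> cheb (- 2 * cox_coeff W i j)"
  shows "word_act W (alt i j k) (basis_vec i) =
    (if even k then scl (p (Suc k)) (basis_vec i) + scl (p k) (basis_vec j)
     else scl (p k) (basis_vec i) + scl (p (Suc k)) (basis_vec j))"
proof (induction k)
  case 0
  then show ?case by (simp add: p_def)
next
  case (Suc k)
  have i: "geom_refl W i (scl a (basis_vec i) + scl b (basis_vec j)) =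
      scl (- 2 * cox_coeff W i j * b - a) (basis_vec i) + scl b (basis_vec j)" for a b
    using assms(1,2)
    by (intro poly_mapping_eqI)
       (simp add: geom_refl_add geom_refl_scl geom_refl_basis cox_coeff_same lookup_add
          lookup_minus lookup_single when_def algebra_simps)
  have j: "geom_refl W j (scl a (basis_vec i) + scl b (basis_vec j)) =
      scl a (basis_vec i) + scl (- 2 * cox_coeff W i j * a - b) (basis_vec j)" for a b
    using assms(1,2)
    by (intro poly_mapping_eqI)
       (simp add: geom_refl_add geom_refl_scl geom_refl_basis cox_coeff_same lookup_add
          lookup_minus lookup_single when_def cox_coeff_sym[of j i] algebra_simps)
  show ?case
    using Suc i j by (auto simp: p_def)
qed

text \<open>For finite \<open>m\<close> the form is nondegenerate on the plane of two distinct
  simple roots. Hence every vector is a combination of these roots plus a vector orthogonal to both,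
  and the relator fixes all three.\<close>

lemma word_act_relator:
  assumes "i \<in> ix" "j \<in> ix" "cox_mat W i j \<noteq> 0"
  shows "word_act W (alt i j (2 * cox_mat W i j)) x = x"
proof (cases "i = j")
  case True
  then show ?thesis
    using assms by (simp add: cox_mat_same numeral_2_eq_2 geom_refl_invol)
next
  case False
  define m where "m = cox_mat W i j"
  define c where "c = cox_coeff W i j"
  define \<theta> where "\<theta> = pi / real m"
  have m: "m \<ge> 2" using assms False cox_mat_neq_1[of i j] by (simp add: m_def)
  have \<theta>: "0 < \<theta>" "\<theta> < pi" using m by (auto simp: \<theta>_def field_simps)
  then have sin: "sin \<theta> > 0" by (rule sin_gt_zero)
  have c: "c = - cos \<theta>" using m by (simp add: c_def cox_coeff_def \<theta>_def m_def)
  define p where "p = cheb (- 2 * c)"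
  have p: "p k = sin (real k * \<theta>) / sin \<theta>" for k
    using cheb_cos[of \<theta> k] sin by (simp add: p_def c field_simps)
  \<comment> \<open>After \<open>2 * m\<close> steps the angle is a full turn, so the values of
    \<open>p\<close> at \<open>2 * m\<close> and its two neighbours are
    \<open>sin x / sin \<theta>\<close> for \<open>x\<close> equal to 0, \<open>\<theta>\<close> and
    \<open>- \<theta>\<close>.\<close>
  have m\<theta>: "real (2 * m) * \<theta> = 2 * pi" using m by (simp add: \<theta>_def)
  have "real (Suc (2 * m)) * \<theta> = \<theta> + 2 * pi" using m\<theta> by (simp add: algebra_simps)
  then have p1: "p (Suc (2 * m)) = 1" unfolding p using sin by (simp del: of_nat_Suc)
  have p0: "p (2 * m) = 0" unfolding p m\<theta> by simp
  have "real (2 * m - 1) * \<theta> = - \<theta> + 2 * pi" using m m\<theta> by (simp add: of_nat_diff algebra_simps)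
  then have p2: "p (2 * m - 1) = - 1" unfolding p using sin by (simp only: sin_periodic sin_minus) simp
  have ei: "word_act W (alt i j (2 * m)) (basis_vec i) = basis_vec i"
    using word_act_alt[OF assms(1,2), of "2 * m"] p0 p1 by (simp add: p_def c_def)
  \<comment> \<open>The last letter negates the simple root of \<open>j\<close>; the rest of the
    word is then computed with the roles of \<open>i\<close> and \<open>j\<close> exchanged.\<close>
  have "alt i j (2 * m) = alt j i (2 * m - 1) @ [j]"
    using alt_Suc_right[of i j "2 * m - 1"] m by simp
  moreover have "word_act W (alt j i (2 * m - 1)) (basis_vec j) = - basis_vec j"
    using word_act_alt[OF assms(2,1), of "2 * m - 1"] p0 p2 m
    by (simp add: p_def c_def cox_coeff_sym[OF assms(2,1)])
  ultimately have ej: "word_act W (alt i j (2 * m)) (basis_vec j) = basis_vec j"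
    using assms by (simp add: geom_refl_basis_same word_act_uminus)
  define fi where "fi = B (basis_vec i) x"
  define fj where "fj = B (basis_vec j) x"
  \<comment> \<open>\<open>D\<close> is the Gram determinant of the two simple roots, equal to the
    square of \<open>sin \<theta>\<close>. The coefficients \<open>a\<close> and \<open>b\<close>
    solve the linear system that makes \<open>x0\<close> orthogonal to both roots.\<close>
  define D where "D = 1 - c\<^sup>2"
  have D: "D \<noteq> 0" using sin sin_squared_eq[of \<theta>] by (auto simp: D_def c)
  define a where "a = (fi - c * fj) / D"
  define b where "b = (fj - c * fi) / D"
  define x0 where "x0 = x - scl a (basis_vec i) - scl b (basis_vec j)"
  have "D * fi = (fi - c * fj) + c * (fj - c * fi)" "D * fj = (fj - c * fi) + c * (fi - c * fj)"
    by (auto simp: D_def algebra_simps power2_eq_square)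
  then have "fi = a + c * b" "fj = b + c * a"
    using D by (auto simp: a_def b_def field_simps)
  then have "B (basis_vec i) x0 = 0" "B (basis_vec j) x0 = 0"
    using assms(1,2)
    by (auto simp: x0_def cox_form_linear cox_form_basis cox_coeff_same fi_def fj_def c_def
        cox_coeff_sym[OF assms(2,1)])
  then have fixed: "word_act W (alt i j (2 * m)) x0 = x0"
    using alt_in_lists[of i "{i, j}" j "2 * m"] by (intro word_act_fixed) auto
  have "x = x0 + scl a (basis_vec i) + scl b (basis_vec j)" by (simp add: x0_def)
  then have "word_act W (alt i j (2 * m)) x = x"
    using fixed ei ej by (simp add: word_act_add word_act_scl)
  then show ?thesis by (simp add: m_def)
qed

section \<open>The group action and the invariance of the form\<close>

lemma word_act_cong: "cox_cong ix (cox_mat W) xs ys \<Longrightarrow> word_act W xs x = word_act W ys x"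
proof (induction rule: cox_cong.induct)
  case (cong_relator xs ys i j)
  then show ?case
    using word_act_relator[of i j] by (simp add: concat_replicate_alt)
qed auto

lemma geom_act_val:
  assumes "xs \<in> lists ix"
  shows "geom_act W (val xs) x = word_act W xs x"
  unfolding geom_act_def
proof (rule the_equality)
  show "\<exists>ys\<in>lists ix. val ys = val xs \<and> word_act W xs x = word_act W ys x"
    using assms by blast
  show "y = word_act W xs x" if "\<exists>ys\<in>lists ix. val ys = val xs \<and> y = word_act W ys x" for y
    using that assms presented word_act_cong by blast
qed

abbreviation "act \<equiv> geom_act W"

lemma act_one [simp]: "act \<one> x = x"
  using geom_act_val[of "[]"] by simp

lemma act_mult:
  assumes "v \<in> carrier W" "w \<in> carrier W"
  shows "act (v \<otimes> w) x = act v (act w x)"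
proof -
  obtain xs ys where "xs \<in> lists ix" "ys \<in> lists ix" "v = val xs" "w = val ys"
    using assms carrier_words by auto
  then show ?thesis
    using geom_act_val[of "xs @ ys"] by (simp add: val_append geom_act_val)
qed

lemma act_s: "i \<in> ix \<Longrightarrow> act (s i) x = geom_refl W i x"
  using geom_act_val[of "[i]"] by simp

lemma act_add: "w \<in> carrier W \<Longrightarrow> act w (x + y) = act w x + act w y"
  and act_scl: "w \<in> carrier W \<Longrightarrow> act w (scl c x) = scl c (act w x)"
  and act_uminus: "w \<in> carrier W \<Longrightarrow> act w (- x) = - act w x"
  by (erule word_cases; simp add: geom_act_val word_act_add word_act_scl word_act_uminus)+

lemma act_diff: "w \<in> carrier W \<Longrightarrow> act w (x - y) = act w x - act w y"
  using act_add[of w x "-y"] by (simp add: act_uminus)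

lemma act_zero: "w \<in> carrier W \<Longrightarrow> act w 0 = 0"
  using act_scl[of w 0 0] by simp

lemma act_inv_cancel [simp]:
  "w \<in> carrier W \<Longrightarrow> act (inv w) (act w x) = x"
  "w \<in> carrier W \<Longrightarrow> act w (act (inv w) x) = x"
  by (auto simp: act_mult[symmetric])

text \<open>The Coxeter matrix is constrained on \<open>ix\<close> only, so symmetry and invariance
  of the form are proved for vectors supported there. The action has to preserve this
  support.\<close>

lemma keys_act:
  assumes "w \<in> carrier W" "keys x \<subseteq> ix"
  shows "keys (act w x) \<subseteq> ix"
proof -
  have "keys (geom_refl W i y) \<subseteq> ix" if "keys y \<subseteq> ix" "i \<in> ix" for i y
    using that keys_diff[of y "Poly_Mapping.single i (2 * cox_form W (basis_vec i) y)"]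
    by (fastforce simp: geom_refl_def split: if_splits)
  then have "xs \<in> lists ix \<Longrightarrow> keys (word_act W xs x) \<subseteq> ix" for xs
    using assms(2) by (induction xs) auto
  then show ?thesis using assms(1) by (metis word_cases geom_act_val)
qed

lemma B_sym:
  assumes "keys x \<subseteq> ix" "keys y \<subseteq> ix"
  shows "B x y = B y x"
proof -
  have "B x y = (\<Sum>i\<in>keys x. \<Sum>j\<in>keys y. lookup x i * lookup y j * cox_coeff W i j)"
    by (rule cox_form_superset) auto
  also have "\<dots> = (\<Sum>j\<in>keys y. \<Sum>i\<in>keys x. lookup x i * lookup y j * cox_coeff W i j)"
    by (rule sum.swap)
  also have "\<dots> = (\<Sum>j\<in>keys y. \<Sum>i\<in>keys x. lookup y j * lookup x i * cox_coeff W j i)"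
    using assms by (intro sum.cong) (auto simp: subset_iff cox_coeff_sym)
  also have "\<dots> = B y x"
    by (rule cox_form_superset[symmetric]) auto
  finally show ?thesis .
qed

lemma B_geom_refl:
  assumes "i \<in> ix" "keys x \<subseteq> ix" "keys y \<subseteq> ix"
  shows "B (geom_refl W i x) (geom_refl W i y) = B x y"
  using assms B_sym[of x "basis_vec i"]
  by (simp add: geom_refl_conv cox_form_linear cox_form_basis cox_coeff_same algebra_simps)

lemma B_act:
  assumes "w \<in> carrier W" "keys x \<subseteq> ix" "keys y \<subseteq> ix"
  shows "B (act w x) (act w y) = B x y"
proof -
  have "xs \<in> lists ix \<Longrightarrow> B (act (val xs) x) (act (val xs) y) = B x y" for xs
  proof (induction xs)
    case (Cons i xs)
    then show ?case
      using B_geom_refl[of i "act (val xs) x" "act (val xs) y"] keys_act assms(2,3)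
      by (auto simp: act_mult act_s)
  qed simp
  then show ?thesis using assms(1) by (metis word_cases)
qed

end

section \<open>Signs of roots, exchange condition and the reflection cocycle\<close>

definition nonneg :: "('a \<Rightarrow>\<^sub>0 real) \<Rightarrow> bool" where
  "nonneg x \<longleftrightarrow> (\<forall>k. 0 \<le> lookup x k)"

lemma nonneg_add: "nonneg x \<Longrightarrow> nonneg y \<Longrightarrow> nonneg (x + y)"
  by (simp add: nonneg_def lookup_add)

lemma nonneg_scl: "0 \<le> c \<Longrightarrow> nonneg x \<Longrightarrow> nonneg (scl c x)"
  by (simp add: nonneg_def)

lemma nonneg_basis_vec [simp]: "nonneg (basis_vec i)"
  by (simp add: nonneg_def lookup_single when_def)

lemma nonneg_antisym: "nonneg x \<Longrightarrow> nonneg (- x) \<Longrightarrow> x = 0"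
  by (intro poly_mapping_eqI) (auto simp: nonneg_def intro: antisym)

lemma basis_vec_neq_0 [simp]: "basis_vec i \<noteq> 0"
  by (metis lookup_single_eq lookup_zero zero_neq_one)

context coxeter_system
begin

lemma len_mult_s:
  assumes "w \<in> carrier W" "i \<in> ix"
  shows "len (w \<otimes> s i) \<le> Suc (len w)" "len w \<le> Suc (len (w \<otimes> s i))"
  using len_mult[of w "s i"] len_mult[of "w \<otimes> s i" "s i"] len_s_le[of i] assms by auto

lemma s_cancel_mid: "v \<in> carrier W \<Longrightarrow> z \<in> carrier W \<Longrightarrow> i \<in> ix \<Longrightarrow> v \<otimes> s i \<otimes> (s i \<otimes> z) = v \<otimes> z"
  by (simp add: m_assoc)

lemma inv_cancel [simp]:
  "x \<in> carrier W \<Longrightarrow> z \<in> carrier W \<Longrightarrow> inv x \<otimes> (x \<otimes> z) = z"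
  "x \<in> carrier W \<Longrightarrow> z \<in> carrier W \<Longrightarrow> x \<otimes> (inv x \<otimes> z) = z"
  by (simp_all add: m_assoc[symmetric])

text \<open>Dihedral reduction: if \<open>w s\<^sub>j < w\<close>, split off from \<open>w\<close> a longest possible suffix alternating in
  \<open>i\<close> and \<open>j\<close>. If it had length at least \<open>m i j\<close>, the braid relation would let \<open>w\<close> end in \<open>i\<close>,
  against the assumption. So it maps the simple root of \<open>i\<close> to a combination of those of \<open>i\<close> and
  \<open>j\<close> whose coefficients are Chebyshev values \<open>sin (k\<pi>/m) / sin (\<pi>/m)\<close> with \<open>k \<le> m\<close>, and the remaining
  prefix has neither \<open>i\<close> nor \<open>j\<close> as a right descent.\<close>

theorem act_basis_nonneg:
  assumes "w \<in> carrier W" "i \<in> ix" "\<not> len (w \<otimes> s i) < len w"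
  shows "nonneg (act w (basis_vec i))"
  using assms
proof (induction "len w" arbitrary: w i rule: less_induct)
  case less
  note w = less.prems(1) and i = less.prems(2)
  show ?case
  proof (cases "w = \<one>")
    case False
    obtain j where j: "j \<in> ix" "len w = Suc (len (w \<otimes> s j))"
      using last_letter[OF w False] by blast
    have lists: "alt i j k \<in> lists ix" "alt j i k \<in> lists ix" for k
      using i j alt_in_lists by fast+
    define P where
      "P k \<longleftrightarrow> (\<exists>v\<in>carrier W. w = v \<otimes> val (alt i j k) \<and> len v + k = len w)" for k
    define k where "k = Greatest P"
    have P1: "P 1" unfolding P_def
      using w j by (intro bexI[of _ "w \<otimes> s j"]) auto
    have P_le: "y \<le> len w" if "P y" for y using that by (auto simp: P_def)
    have "P k" unfolding k_def by (rule GreatestI_nat[of P, OF P1 P_le])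
    then obtain v where v: "v \<in> carrier W" "w = v \<otimes> val (alt i j k)" "len v + k = len w"
      by (auto simp: P_def)
    have k_max: "y \<le> k" if "P y" for y
      unfolding k_def by (rule Greatest_le_nat[of P, OF that P_le])
    obtain k' where k': "k = Suc k'" using k_max[OF P1] by (cases k) auto
    \<comment> \<open>\<open>x\<close> is the letter that would extend the suffix to the left,
      \<open>y\<close> the letter with which it begins. Maximality of \<open>k\<close> excludes
      \<open>x\<close> as a right descent of \<open>v\<close>; for \<open>y\<close> the reason is
      that the lengths of \<open>v\<close> and of the suffix add up to that of
      \<open>w\<close>.\<close>
    define x where "x = (if even k then j else i)"
    define y where "y = (if even k then i else j)"
    have xy: "x \<in> ix" "y \<in> ix" using i j by (auto simp: x_def y_def)
    have alt_up: "alt i j (Suc k) = x # alt i j k" by (simp add: x_def)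
    have alt_down: "alt i j k = y # alt i j k'" by (simp add: y_def k')
    have "\<not> len (v \<otimes> s x) < len v"
    proof
      assume "len (v \<otimes> s x) < len v"
      then have A1: "len (v \<otimes> s x) + Suc k = len w"
        using len_mult_s(2)[OF v(1) xy(1)] v(3) by simp
      have A2: "w = (v \<otimes> s x) \<otimes> val (alt i j (Suc k))"
        unfolding alt_up val_Cons v(2) using v(1) xy(1) val_closed[OF lists(1)]
        by (subst s_cancel_mid) simp_all
      have "P (Suc k)" unfolding P_def
        by (intro bexI[of _ "v \<otimes> s x"] conjI A1 A2 m_closed v(1) s_closed xy(1))
      then show False using k_max by fastforce
    qed
    then have x: "nonneg (act v (basis_vec x))"
      using less.hyps v xy k' by simp
    have "\<not> len (v \<otimes> s y) < len v"
    proof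
      assume *: "len (v \<otimes> s y) < len v"
      have "w = (v \<otimes> s y) \<otimes> val (alt i j k')"
        using v(2) v(1) xy lists alt_down by (simp add: m_assoc)
      then have "len w \<le> len (v \<otimes> s y) + len (val (alt i j k'))"
        using len_mult v(1) xy lists by simp
      also have "\<dots> \<le> len (v \<otimes> s y) + k'"
        using len_val_le[OF lists(1), of k'] by simp
      finally show False using * v(3) k' by simp
    qed
    then have y: "nonneg (act v (basis_vec y))"
      using less.hyps v xy k' by simp
    have ij: "nonneg (act v (basis_vec i))" "nonneg (act v (basis_vec j))"
      using x y by (auto simp: x_def y_def split: if_splits)
    define m where "m = cox_mat W i j"
    have k_less: "k < m" if "m \<noteq> 0"
    proof (rule ccontr)
      assume "\<not> k < m"
      then obtain n where n: "k = n + m" by (metis le_add_diff_inverse2 not_less)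
      obtain m' where m': "m = Suc m'" using \<open>m \<noteq> 0\<close> by (cases m) auto
      define X where "X = (if even m then alt i j n else alt j i n)"
      have X: "X \<in> lists ix" "length X = n" using lists by (auto simp: X_def)
      have "val (alt i j m) = val (alt j i m)"
        using braid[OF i j(1)] that by (simp add: m_def)
      then have "w = v \<otimes> (val X \<otimes> val (alt j i m))"
        using v(2) unfolding n alt_add X_def[symmetric] using X lists by (simp add: val_append)
      moreover have "alt j i m = alt i j m' @ [i]"
        unfolding m' by (rule alt_Suc_right)
      ultimately have "w \<otimes> s i = v \<otimes> val (X @ alt i j m')"
        using X(1) lists v(1) i by (simp add: val_append m_assoc)
      then have "len (w \<otimes> s i) \<le> len v + len (val (X @ alt i j m'))"
        using len_mult[of v "val (X @ alt i j m')"] v(1) X(1) lists by simp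
      also have "\<dots> \<le> len v + (n + m')"
        using len_val_le[of "X @ alt i j m'"] X lists by simp
      finally show False using less.prems(3) v(3) n m' by simp
    qed
    define p where "p = cheb (- 2 * cox_coeff W i j)"
    \<comment> \<open>For finite \<open>m\<close>, \<open>n \<le> k + 1 \<le> m\<close> keeps the
      argument of the sine between 0 and \<open>pi\<close>; for infinite \<open>m\<close> the value
      is \<open>n\<close> itself.\<close>
    have p: "0 \<le> p n" if "n \<le> Suc k" for n
    proof (cases "m = 0")
      case True
      then show ?thesis by (simp add: p_def cox_coeff_def m_def cheb_two)
    next
      case False
      have "m \<noteq> 1" using k_less k' by auto
      then have m: "m \<ge> 2" using False by simp
      have n: "n \<le> m" using k_less[OF False] that by simp
      have sin: "0 < sin (pi / m)" using m by (intro sin_gt_zero) (auto simp: field_simps)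
      have "0 \<le> sin (real n * (pi / m))"
        using n m by (intro sin_ge_zero) (auto simp: field_simps)
      then have "0 \<le> cheb (2 * cos (pi / m)) n * sin (pi / m)"
        by (simp add: cheb_cos)
      then show ?thesis
        using sin False by (simp add: p_def cox_coeff_def m_def zero_le_mult_iff)
    qed
    have "act w (basis_vec i) = act v (word_act W (alt i j k) (basis_vec i))"
      using v(1,2) lists by (simp add: act_mult geom_act_val)
    then show ?thesis
      using word_act_alt[OF i j(1), of k] ij p[of k] p[of "Suc k"] v(1)
      by (auto simp: p_def act_add act_scl intro!: nonneg_add nonneg_scl)
  qed simp
qed

lemma act_basis_neq_0: "w \<in> carrier W \<Longrightarrow> act w (basis_vec i) \<noteq> 0"
  by (metis act_inv_cancel(1) act_zero basis_vec_neq_0 inv_closed)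

lemma act_mult_s: "w \<in> carrier W \<Longrightarrow> i \<in> ix \<Longrightarrow> act (w \<otimes> s i) (basis_vec i) = - act w (basis_vec i)"
  by (simp add: act_mult act_s geom_refl_basis_same act_uminus)

text \<open>Apply the positivity theorem to \<open>w\<close> and to \<open>w \<otimes> s i\<close>,
  which send the simple root to opposite vectors. A nonzero vector cannot be nonnegative together
  with its opposite, so the two lengths also differ.\<close>

lemma act_basis_pos_iff:
  assumes "w \<in> carrier W" "i \<in> ix"
  shows "nonneg (act w (basis_vec i)) \<longleftrightarrow> len w < len (w \<otimes> s i)"
    and "nonneg (- act w (basis_vec i)) \<longleftrightarrow> len (w \<otimes> s i) < len w"
proof -
  have 1: "nonneg (act w (basis_vec i))" if "len w \<le> len (w \<otimes> s i)"
    using act_basis_nonneg[OF assms] that by simp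
  have 2: "nonneg (- act w (basis_vec i))" if "len (w \<otimes> s i) \<le> len w"
    using act_basis_nonneg[of "w \<otimes> s i" i] that assms by (simp add: act_mult_s)
  have 3: "\<not> (nonneg (act w (basis_vec i)) \<and> nonneg (- act w (basis_vec i)))"
    using nonneg_antisym act_basis_neq_0 assms(1) by blast
  show "nonneg (act w (basis_vec i)) \<longleftrightarrow> len w < len (w \<otimes> s i)"
    using 1 2 3 by (meson linorder_le_less_linear less_imp_le_nat)
  show "nonneg (- act w (basis_vec i)) \<longleftrightarrow> len (w \<otimes> s i) < len w"
    using 1 2 3 by (meson linorder_le_less_linear less_imp_le_nat)
qed

lemma root_sign: "w \<in> carrier W \<Longrightarrow> i \<in> ix \<Longrightarrow>
    nonneg (- act w (basis_vec i)) \<longleftrightarrow> \<not> nonneg (act w (basis_vec i))"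
  using act_basis_nonneg[of w i] act_basis_pos_iff[of w i] by auto

text \<open>A nontrivial element has a right descent, and the simple root of that descent becomes
  negative.\<close>

lemma act_faithful:
  assumes "w \<in> carrier W" "\<And>i. i \<in> ix \<Longrightarrow> act w (basis_vec i) = basis_vec i"
  shows "w = \<one>"
proof (rule ccontr)
  assume "w \<noteq> \<one>"
  then obtain i where "i \<in> ix" "len (w \<otimes> s i) < len w"
    using last_letter[OF assms(1)] by (metis lessI)
  then show False
    using act_basis_pos_iff[of w i] root_sign[of w i] assms by simp
qed

section \<open>Reflections and their roots\<close>

abbreviation "rfl x i \<equiv> x \<otimes> s i \<otimes> inv x"

lemma act_rfl:
  assumes "x \<in> carrier W" "i \<in> ix" "keys y \<subseteq> ix"
  shows "act (rfl x i) y = y - scl (2 * B (act x (basis_vec i)) y) (act x (basis_vec i))"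
proof -
  have "B (act x (basis_vec i)) y = B (act x (basis_vec i)) (act x (act (inv x) y))"
    using assms by simp
  also have "\<dots> = B (basis_vec i) (act (inv x) y)"
    using assms by (intro B_act) (auto simp: keys_act dest: keys_act[THEN subsetD, rotated 2])
  finally show ?thesis
    using assms by (simp add: act_mult act_s geom_refl_conv act_diff act_scl)
qed

lemma rfl_closed [simp]: "x \<in> carrier W \<Longrightarrow> i \<in> ix \<Longrightarrow> rfl x i \<in> carrier W"
  by simp

text \<open>The formula for the reflection is unchanged when the root changes sign, so both elements
  act alike and faithfulness applies. This makes \<open>root_refl\<close> well defined.\<close>

lemma rfl_unique:
  assumes "x \<in> carrier W" "i \<in> ix" "y \<in> carrier W" "j \<in> ix"
    and "act y (basis_vec j) = act x (basis_vec i) \<or> act y (basis_vec j) = - act x (basis_vec i)"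
  shows "rfl y j = rfl x i"
proof -
  have eq: "act (rfl x i) z = act (rfl y j) z" if "keys z \<subseteq> ix" for z
    using assms that by (auto simp: act_rfl cox_form_linear scl_uminus)
  have "inv (rfl x i) \<otimes> rfl y j = \<one>"
    using assms(1-4) eq by (intro act_faithful) (auto simp: act_mult[of "inv (rfl x i)"] eq[symmetric])
  then show ?thesis
    using assms(1-4) by (metis inv_closed inv_equality inv_inv rfl_closed)
qed

lemma rfl_in_refls: "x \<in> carrier W \<Longrightarrow> i \<in> ix \<Longrightarrow> rfl x i \<in> refls"
  by (auto simp: cox_reflections_def)

text \<open>A negative root is replaced by its opposite, which \<open>x \<otimes> s i\<close>
  provides together with the same reflection.\<close>

lemma rfl_cases:
  assumes "t \<in> refls"
  obtains x i where "x \<in> carrier W" "i \<in> ix" "t = rfl x i" "nonneg (act x (basis_vec i))"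
proof -
  obtain x i where x: "x \<in> carrier W" "i \<in> ix" "t = rfl x i"
    using assms by (auto simp: cox_reflections_def)
  show ?thesis
  proof (cases "nonneg (act x (basis_vec i))")
    case False
    then have "nonneg (act (x \<otimes> s i) (basis_vec i))"
      using x root_sign by (simp add: act_mult_s)
    moreover have "rfl (x \<otimes> s i) i = t"
      using x rfl_unique[of x i "x \<otimes> s i" i] by (simp add: act_mult_s)
    ultimately show ?thesis using that x by (metis m_closed s_closed)
  qed (use x that in blast)
qed

lemma refls_closed [simp]: "t \<in> refls \<Longrightarrow> t \<in> carrier W"
  by (auto simp: cox_reflections_def)

lemma refls_sq [simp]: "t \<in> refls \<Longrightarrow> t \<otimes> t = \<one>"
  by (erule rfl_cases) (simp add: m_assoc)

lemma refls_inv [simp]: "t \<in> refls \<Longrightarrow> inv t = t"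
  by (simp add: inv_equality)

lemma refls_cancel [simp]: "t \<in> refls \<Longrightarrow> x \<in> carrier W \<Longrightarrow> t \<otimes> (t \<otimes> x) = x"
  by (simp add: m_assoc[symmetric])

lemma s_in_refls [simp]: "i \<in> ix \<Longrightarrow> s i \<in> refls"
  using rfl_in_refls[of \<one> i] by simp

lemma conj_rfl: "g \<in> carrier W \<Longrightarrow> x \<in> carrier W \<Longrightarrow> i \<in> ix \<Longrightarrow> g \<otimes> rfl x i \<otimes> inv g = rfl (g \<otimes> x) i"
  by (simp add: m_assoc inv_mult_group)

lemma refls_conj: "t \<in> refls \<Longrightarrow> g \<in> carrier W \<Longrightarrow> g \<otimes> t \<otimes> inv g \<in> refls"
  using conj_rfl rfl_in_refls by (auto elim!: rfl_cases)

lemma refls_conj': "t \<in> refls \<Longrightarrow> g \<in> carrier W \<Longrightarrow> inv g \<otimes> t \<otimes> g \<in> refls"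
  using refls_conj[of t "inv g"] by simp

text \<open>The simple reflection changes only the coordinate \<open>i\<close>. If this turns a
  positive root negative, all other coordinates vanish, and since roots have norm one the remaining
  coordinate is 1.\<close>

lemma simple_root_sent_negative:
  assumes "x \<in> carrier W" "j \<in> ix" "i \<in> ix"
    and "nonneg (act x (basis_vec j))" "\<not> nonneg (geom_refl W i (act x (basis_vec j)))"
  shows "act x (basis_vec j) = basis_vec i"
proof -
  define b where "b = act x (basis_vec j)"
  have "nonneg (- geom_refl W i b)"
    using root_sign[of "s i \<otimes> x" j] assms by (simp add: act_mult act_s b_def)
  moreover have "lookup (geom_refl W i b) k = lookup b k" if "k \<noteq> i" for k
    using that by (simp add: geom_refl_def lookup_minus lookup_single_not_eq)
  ultimately have "lookup b k = 0" if "k \<noteq> i" for k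
    using assms(4) that unfolding nonneg_def b_def[symmetric]
    by (metis antisym lookup_uminus neg_0_le_iff_le)
  then have b: "b = scl (lookup b i) (basis_vec i)"
    by (intro poly_mapping_eqI) (auto simp: lookup_single when_def)
  have "B b b = 1"
    using assms B_act[of x "basis_vec j" "basis_vec j"]
    by (simp add: b_def cox_form_basis cox_coeff_same)
  then have "B (scl (lookup b i) (basis_vec i)) (scl (lookup b i) (basis_vec i)) = 1"
    using b by simp
  then have "(lookup b i)\<^sup>2 = 1"
    using assms(3) by (simp add: cox_form_linear cox_form_basis cox_coeff_same power2_eq_square)
  moreover have "0 \<le> lookup b i" using assms(4) by (simp add: nonneg_def b_def)
  ultimately have "lookup b i = 1" by (simp add: power2_eq_1_iff)
  then show ?thesis using b by (simp add: b_def)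
qed

section \<open>Exchange condition and cocycle\<close>

text \<open>Let the letters of \<open>xs\<close> act from the right. Just before the letter that
  first makes the root negative, the root is the simple root of that letter; the reflection is then
  conjugate to the letter and cancels it.\<close>

lemma exchange_root:
  assumes "x \<in> carrier W" "j \<in> ix" "nonneg (act x (basis_vec j))"
    and "xs \<in> lists ix" "\<not> nonneg (act (val xs) (act x (basis_vec j)))"
  shows "\<exists>us i vs. xs = us @ i # vs \<and> val xs \<otimes> rfl x j = val (us @ vs)"
  using assms(4,5)
proof (induction xs)
  case Nil
  then show ?case using assms by simp
next
  case (Cons i xs)
  then have i: "i \<in> ix" and xs: "xs \<in> lists ix" by auto
  show ?case
  proof (cases "nonneg (act (val xs) (act x (basis_vec j)))")
    case False
    then obtain us k vs where *: "xs = us @ k # vs" "val xs \<otimes> rfl x j = val (us @ vs)"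
      using Cons.IH xs by blast
    then have "val (i # xs) \<otimes> rfl x j = val ((i # us) @ vs)"
      using i xs assms by (simp add: m_assoc)
    then show ?thesis using * by (metis append_Cons)
  next
    case True
    have "act (val xs \<otimes> x) (basis_vec j) = basis_vec i"
      using True Cons.prems i xs assms
      by (intro simple_root_sent_negative) (auto simp: act_mult act_s)
    then have "rfl (val xs \<otimes> x) j = rfl \<one> i"
      using i xs assms by (intro rfl_unique) auto
    then have "val xs \<otimes> rfl x j \<otimes> inv (val xs) = s i"
      using conj_rfl xs assms i by simp
    then have "val xs \<otimes> rfl x j = s i \<otimes> val xs"
      using xs assms i by (metis inv_closed inv_solve_right m_closed rfl_closed s_closed val_closed)
    then have "val (i # xs) \<otimes> rfl x j = val ([] @ xs)"
      using i xs assms by (simp add: m_assoc)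
    then show ?thesis by blast
  qed
qed

text \<open>If the root becomes negative, exchange deletes a letter from a reduced word of
  \<open>w\<close>. Otherwise the same applies to \<open>w\<close> times the reflection, because the
  reflection negates its own root.\<close>

lemma len_mult_rfl:
  assumes x: "x \<in> carrier W" "j \<in> ix" "nonneg (act x (basis_vec j))" and w: "w \<in> carrier W"
  shows "len (w \<otimes> rfl x j) < len w \<longleftrightarrow> \<not> nonneg (act w (act x (basis_vec j)))"
    and "len w < len (w \<otimes> rfl x j) \<longleftrightarrow> nonneg (act w (act x (basis_vec j)))"
proof -
  have 1: "len (v \<otimes> rfl x j) < len v"
    if v: "v \<in> carrier W" "\<not> nonneg (act v (act x (basis_vec j)))" for v
  proof -
    obtain xs where xs: "xs \<in> lists ix" "val xs = v" "length xs = len v"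
      using reduced_word v(1) by blast
    then obtain us i vs where *: "xs = us @ i # vs" "val xs \<otimes> rfl x j = val (us @ vs)"
      using exchange_root[OF x xs(1)] v by blast
    then show ?thesis using xs len_val_le[of "us @ vs"] by simp
  qed
  have sq: "rfl x j \<otimes> rfl x j = \<one>" using x rfl_in_refls refls_sq by blast
  have "act (rfl x j) (act x (basis_vec j)) = - act x (basis_vec j)"
    using x by (simp add: act_mult act_s geom_refl_basis_same act_uminus)
  then have "act (w \<otimes> rfl x j) (act x (basis_vec j)) = - act w (act x (basis_vec j))"
    using w x by (simp add: act_mult[of w "rfl x j"] act_uminus)
  moreover have "\<not> nonneg (- act w (act x (basis_vec j)))" if "nonneg (act w (act x (basis_vec j)))"
    using that root_sign[of "w \<otimes> x" j] w x by (simp add: act_mult)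
  ultimately have 2: "len w < len (w \<otimes> rfl x j)" if "nonneg (act w (act x (basis_vec j)))"
    using 1[of "w \<otimes> rfl x j"] that w x sq by (simp add: m_assoc[of w])
  show "len (w \<otimes> rfl x j) < len w \<longleftrightarrow> \<not> nonneg (act w (act x (basis_vec j)))"
    and "len w < len (w \<otimes> rfl x j) \<longleftrightarrow> nonneg (act w (act x (basis_vec j)))"
    using 1[OF w] 2 by (metis order.asym)+
qed

lemma len_rfl_mult:
  assumes x: "x \<in> carrier W" "j \<in> ix" "nonneg (act x (basis_vec j))" and w: "w \<in> carrier W"
  shows "len (rfl x j \<otimes> w) < len w \<longleftrightarrow> \<not> nonneg (act (inv w) (act x (basis_vec j)))"
    and "len w < len (rfl x j \<otimes> w) \<longleftrightarrow> nonneg (act (inv w) (act x (basis_vec j)))"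
proof -
  have "inv (rfl x j \<otimes> w) = inv w \<otimes> rfl x j"
    using x w rfl_in_refls refls_inv by (metis inv_mult_group rfl_closed)
  then have "len (rfl x j \<otimes> w) = len (inv w \<otimes> rfl x j)"
    using x w by (metis len_inv m_closed rfl_closed)
  then show "len (rfl x j \<otimes> w) < len w \<longleftrightarrow> \<not> nonneg (act (inv w) (act x (basis_vec j)))"
    and "len w < len (rfl x j \<otimes> w) \<longleftrightarrow> nonneg (act (inv w) (act x (basis_vec j)))"
    using len_mult_rfl[OF x, of "inv w"] w by simp_all
qed

lemma len_refl_cases: "t \<in> refls \<Longrightarrow> w \<in> carrier W \<Longrightarrow> len (t \<otimes> w) < len w \<or> len w < len (t \<otimes> w)"
  by (elim rfl_cases) (auto simp: len_rfl_mult)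

text \<open>This is the exchange on the right, applied to the reversed word; inversion then moves
  the reflection to the left.\<close>

lemma strong_exchange:
  assumes t: "t \<in> refls" and xs: "xs \<in> lists ix" and len: "len (t \<otimes> val xs) < len (val xs)"
  shows "\<exists>us i vs. xs = us @ i # vs \<and> t \<otimes> val xs = val (us @ vs)"
proof -
  obtain x j where x: "x \<in> carrier W" "j \<in> ix" "t = rfl x j" "nonneg (act x (basis_vec j))"
    using t rfl_cases by blast
  have rev: "rev xs \<in> lists ix" using xs by (simp add: in_lists_conv_set)
  have "\<not> nonneg (act (val (rev xs)) (act x (basis_vec j)))"
    using len x xs len_rfl_mult[of x j "val xs"] by (simp add: inv_val)
  then obtain us i vs where *: "rev xs = us @ i # vs" "val (rev xs) \<otimes> t = val (us @ vs)"
    using exchange_root[OF x(1,2,4) rev] x(3) by blast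
  then have xs': "xs = rev vs @ i # rev us"
    by (metis append.assoc append_Cons append_Nil rev.simps(2) rev_append rev_rev_ident)
  have "us @ vs \<in> lists ix" using rev *(1) by simp
  then have "inv (val (rev xs) \<otimes> t) = val (rev vs @ rev us)"
    unfolding *(2) by (subst inv_val) auto
  then have "t \<otimes> val xs = val (rev vs @ rev us)"
    using t xs rev by (simp add: inv_mult_group inv_val)
  then show ?thesis using xs' by blast
qed

text \<open>Writing N(w) for the set of reflections that shorten \<open>w\<close> from the left,
  this is the identity N(a b) = N(a) + a N(b) a^-1, with + the symmetric difference. The root of
  \<open>t\<close> passes through \<open>inv a\<close> and then \<open>inv b\<close>, and each
  factor accounts for one possible change of sign.\<close>

lemma cocycle:
  assumes t: "t \<in> refls" and ab: "a \<in> carrier W" "b \<in> carrier W"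
  shows "len (t \<otimes> (a \<otimes> b)) < len (a \<otimes> b) \<longleftrightarrow>
    (len (t \<otimes> a) < len a) \<noteq> (len (inv a \<otimes> t \<otimes> a \<otimes> b) < len b)"
proof -
  obtain x j where x: "x \<in> carrier W" "j \<in> ix" "t = rfl x j" "nonneg (act x (basis_vec j))"
    using t rfl_cases by blast
  define y where "y = inv a \<otimes> x"
  have y: "y \<in> carrier W" using x ab by (simp add: y_def)
  have act_y: "act y (basis_vec j) = act (inv a) (act x (basis_vec j))"
    using x ab by (simp add: y_def act_mult)
  have conj: "inv a \<otimes> t \<otimes> a = rfl y j"
    using conj_rfl[of "inv a" x j] x ab by (simp add: y_def)
  have inv: "act (inv (a \<otimes> b)) z = act (inv b) (act (inv a) z)" for z
    using ab by (simp add: inv_mult_group act_mult)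
  show ?thesis
  proof (cases "nonneg (act y (basis_vec j))")
    case True
    then show ?thesis
      using len_rfl_mult[OF x(1,2,4)] len_rfl_mult[OF y x(2) True] ab
      by (simp add: x(3)[symmetric] conj inv act_y)
  next
    case False
    \<comment> \<open>The root of the conjugated reflection is negative here. The length criterion
      requires the positive root, which \<open>z\<close> provides, and this reverses the sign under
      \<open>inv b\<close>.\<close>
    define z where "z = y \<otimes> s j"
    have z: "z \<in> carrier W" "act z (basis_vec j) = - act y (basis_vec j)"
      using x y by (auto simp: z_def act_mult_s)
    have zn: "nonneg (act z (basis_vec j))" using False z root_sign x y by simp
    have "rfl z j = rfl y j" using rfl_unique[of y j z j] x y z by simp
    moreover have "nonneg (act (inv b) (act z (basis_vec j))) \<longleftrightarrow>
        \<not> nonneg (act (inv b) (act y (basis_vec j)))"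
      using root_sign[of "inv b \<otimes> y" j] x y ab z by (simp add: act_mult act_uminus)
    ultimately show ?thesis
      using False len_rfl_mult[OF x(1,2,4)] len_rfl_mult[OF z(1) x(2) zn] ab
      by (simp add: x(3)[symmetric] conj inv act_y)
  qed
qed

lemma s_neq_one: "i \<in> ix \<Longrightarrow> s i \<noteq> \<one>"
  using act_basis_pos_iff[of \<one> i] by auto

lemma len_s: "i \<in> ix \<Longrightarrow> len (s i) = 1"
  using len_s_le[of i] s_neq_one[of i] len_eq_0[of "s i"] by (cases "len (s i)") auto

lemma refl_descent_s:
  assumes "t \<in> refls" "i \<in> ix"
  shows "len (t \<otimes> s i) < len (s i) \<longleftrightarrow> t = s i"
proof -
  have "len (t \<otimes> s i) < len (s i) \<longleftrightarrow> t \<otimes> s i = \<one>"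
    using assms by (simp add: len_s len_eq_0)
  also have "\<dots> \<longleftrightarrow> t = s i"
    using assms by (metis inv_equality inv_s s_sq refls_closed s_closed)
  finally show ?thesis .
qed

text \<open>In the cocycle identity with second factor \<open>s i\<close>, only the reflection
  \<open>x s_i x^-1\<close> changes its status, and the last assumption says that \<open>t\<close>
  differs from it.\<close>

lemma refl_descent_mult_s:
  assumes "t \<in> refls" "x \<in> carrier W" "i \<in> ix" "t \<otimes> x \<noteq> x \<otimes> s i"
  shows "len (t \<otimes> (x \<otimes> s i)) < len (x \<otimes> s i) \<longleftrightarrow> len (t \<otimes> x) < len x"
proof -
  have "inv x \<otimes> t \<otimes> x \<noteq> s i"
    using assms by (metis inv_closed inv_solve_left m_assoc m_closed refls_closed s_closed)
  then show ?thesis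
    using cocycle[OF assms(1,2), of "s i"] refl_descent_s[OF refls_conj'[OF assms(1,2)] assms(3)] assms
    by simp
qed

end

section \<open>Parabolic subgroups and minimal coset representatives\<close>

context coxeter_system
begin

lemma parabolic_closed: "J \<subseteq> ix \<Longrightarrow> w \<in> parabolic W J \<Longrightarrow> w \<in> carrier W"
  by (meson parabolic_subgroup subgroup.mem_carrier)

lemma parabolic_mult: "J \<subseteq> ix \<Longrightarrow> v \<in> parabolic W J \<Longrightarrow> w \<in> parabolic W J \<Longrightarrow> v \<otimes> w \<in> parabolic W J"
  by (meson parabolic_subgroup subgroup.m_closed)

lemma parabolic_inv: "J \<subseteq> ix \<Longrightarrow> w \<in> parabolic W J \<Longrightarrow> inv w \<in> parabolic W J"
  by (meson parabolic_subgroup subgroup.m_inv_closed)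

lemma parabolic_one: "J \<subseteq> ix \<Longrightarrow> \<one> \<in> parabolic W J"
  by (meson parabolic_subgroup subgroup.one_closed)

lemma parabolic_s: "j \<in> J \<Longrightarrow> s j \<in> parabolic W J"
  by (simp add: parabolic_def generate.incl)

lemma parabolic_val: "J \<subseteq> ix \<Longrightarrow> xs \<in> lists J \<Longrightarrow> val xs \<in> parabolic W J"
  using parabolic_words by blast

text \<open>Start from any word over \<open>J\<close> and process it from its right end. Whenever a
  new letter shortens the element, strong exchange deletes a letter, so no letter outside
  \<open>J\<close> can enter.\<close>

lemma parabolic_reduced_word:
  assumes J: "J \<subseteq> ix" and w: "w \<in> parabolic W J"
  obtains xs where "xs \<in> lists J" "val xs = w" "length xs = len w"
proof -
  have ix: "ys \<in> lists ix" if "ys \<in> lists J" for ys using that J by auto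
  have "\<exists>ys\<in>lists J. val ys = val xs \<and> length ys = len (val xs)" if "xs \<in> lists J" for xs
    using that
  proof (induction xs)
    case Nil
    then show ?case by (intro bexI[of _ "[]"]) auto
  next
    case (Cons i xs)
    then have i: "i \<in> J" "i \<in> ix" using J by auto
    obtain ys where ys: "ys \<in> lists J" "val ys = val xs" "length ys = len (val xs)"
      using Cons by auto
    have xs: "xs \<in> lists ix" using Cons ix by simp
    show ?case
    proof (cases "len (s i \<otimes> val ys) < len (val ys)")
      case True
      then obtain us k vs where *: "ys = us @ k # vs" "s i \<otimes> val ys = val (us @ vs)"
        using strong_exchange[of "s i" ys] i ix[OF ys(1)] by auto
      have zs: "us @ vs \<in> lists J" using ys(1) *(1) by simp
      \<comment> \<open>Multiplication by \<open>s i\<close> lowers the length by at most one, and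
        exactly one letter was deleted, so the remaining word is reduced.\<close>
      have "len (val xs) \<le> Suc (len (s i \<otimes> val xs))"
        using len_mult[of "s i" "s i \<otimes> val xs"] len_s_le[of i] i xs by simp
      then have "length (us @ vs) \<le> len (val (us @ vs))"
        using * ys by simp
      then have "length (us @ vs) = len (val (us @ vs))"
        using len_val_le[OF ix[OF zs]] by simp
      then show ?thesis using zs * ys(2) by (intro bexI[of _ "us @ vs"]) auto
    next
      case False
      then have "len (val (i # ys)) \<ge> length (i # ys)"
        using len_refl_cases[of "s i" "val ys"] i ix[OF ys(1)] ys val_closed[OF xs] by simp
      moreover have "i # ys \<in> lists J" using i ys by simp
      ultimately show ?thesis
        using len_val_le[OF ix, of "i # ys"] ys(2) by (intro bexI[of _ "i # ys"]) auto
    qed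
  qed
  then show ?thesis using w that parabolic_words[OF J] by fastforce
qed

text \<open>Strong exchange exhibits \<open>t \<otimes> a\<close> as a subword of a word over
  \<open>J\<close>.\<close>

lemma refl_descent_parabolic:
  assumes J: "J \<subseteq> ix" and a: "a \<in> parabolic W J" and t: "t \<in> refls" "len (t \<otimes> a) < len a"
  shows "t \<in> parabolic W J"
proof -
  obtain xs where xs: "xs \<in> lists J" "val xs = a"
    using parabolic_reduced_word[OF J a] by blast
  have "xs \<in> lists ix" using xs J by auto
  then obtain us i vs where *: "xs = us @ i # vs" "t \<otimes> val xs = val (us @ vs)"
    using strong_exchange t xs by blast
  then have "t \<otimes> a \<in> parabolic W J" using xs J by (auto intro!: parabolic_val)
  then have "(t \<otimes> a) \<otimes> inv a \<in> parabolic W J"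
    using J a parabolic_mult parabolic_inv by blast
  then show ?thesis
    using t parabolic_closed[OF J a] by (simp add: m_assoc)
qed

text \<open>Strong exchange is applied to a word for \<open>t\<close> and the reflection
  \<open>t\<close> itself. Deleting one letter leaves the identity, so the parts on the two sides of
  that letter are inverse to each other.\<close>

lemma refl_in_parabolic:
  assumes J: "J \<subseteq> ix" and t: "t \<in> refls" "t \<in> parabolic W J"
  obtains u j where "u \<in> parabolic W J" "j \<in> J" "t = rfl u j"
proof -
  obtain xs where xs: "xs \<in> lists J" "val xs = t"
    using parabolic_reduced_word[OF J t(2)] by blast
  have ix: "xs \<in> lists ix" using xs J by auto
  have "len (t \<otimes> val xs) < len (val xs)"
    using xs t len_refl_cases[of t t] by simp
  then obtain us j vs where *: "xs = us @ j # vs" "t \<otimes> val xs = val (us @ vs)"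
    using strong_exchange[OF t(1) ix] by blast
  then have lists: "us \<in> lists J" "j \<in> J" "us \<in> lists ix" "vs \<in> lists ix" "j \<in> ix"
    using xs(1) ix by auto
  have "val us \<otimes> val vs = \<one>"
    using * xs(2) t lists by (simp add: val_append)
  then have "val vs = inv (val us)"
    using lists by (metis inv_comm inv_equality val_closed)
  then have "t = rfl (val us) j"
    using xs(2) *(1) lists by (simp add: val_append m_assoc)
  then show ?thesis using that lists J parabolic_val by blast
qed

section \<open>Minimal representatives and the length of products\<close>

definition left_min :: "'i set \<Rightarrow> 'g set" where
  "left_min J = {b \<in> carrier W. \<forall>u\<in>parabolic W J. len b \<le> len (u \<otimes> b)}"

lemma left_min_closed: "b \<in> left_min J \<Longrightarrow> b \<in> carrier W"
  by (simp add: left_min_def)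

lemma inv_in_left_min:
  assumes J: "J \<subseteq> ix" and w: "w \<in> carrier W"
  shows "inv w \<in> left_min J \<longleftrightarrow> w \<in> min_reps W J"
proof -
  have *: "len (u \<otimes> inv w) = len (w \<otimes> inv u)" if "u \<in> parabolic W J" for u
    using that w parabolic_closed[OF J] len_inv[of "w \<otimes> inv u"] by (simp add: inv_mult_group)
  have "(\<forall>u\<in>parabolic W J. len w \<le> len (w \<otimes> inv u)) \<longleftrightarrow> (\<forall>u\<in>parabolic W J. len w \<le> len (w \<otimes> u))"
    using parabolic_inv[OF J] parabolic_closed[OF J] by (metis inv_inv)
  then show ?thesis using w * by (simp add: left_min_def min_reps_def)
qed

text \<open>Let \<open>u\<close> grow on the left along a reduced word. By the cocycle identity a
  drop in length would come either from \<open>u\<close>, whose word is reduced, or from a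
  reflection of the parabolic subgroup that shortens \<open>b\<close>, against minimality.\<close>

lemma len_left_min:
  assumes J: "J \<subseteq> ix" and b: "b \<in> left_min J" and u: "u \<in> parabolic W J"
  shows "len (u \<otimes> b) = len u + len b"
proof -
  have bc: "b \<in> carrier W" using b left_min_closed by blast
  have "len (val xs \<otimes> b) = length xs + len b"
    if "xs \<in> lists J" "length xs = len (val xs)" for xs
    using that
  proof (induction xs rule: list.induct)
    case (Cons i xs)
    then have i: "i \<in> ix" "i \<in> J" "xs \<in> lists J" "xs \<in> lists ix" using J by auto
    have v: "val xs \<in> carrier W" "val xs \<in> parabolic W J" using i J parabolic_val by auto
    have "Suc (length xs) \<le> Suc (len (val xs))"
      using Cons.prems(2) len_mult[of "s i" "val xs"] len_s_le[of i] i by simp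
    then have len: "length xs = len (val xs)" using len_val_le[of xs] i by simp
    then have up: "\<not> len (s i \<otimes> val xs) < len (val xs)" using Cons.prems(2) by simp
    define t where "t = inv (val xs) \<otimes> s i \<otimes> val xs"
    have "t \<in> parabolic W J"
      unfolding t_def using i v J by (intro parabolic_mult parabolic_inv parabolic_s)
    then have "\<not> len (t \<otimes> b) < len b" using b by (auto simp: left_min_def not_less)
    then have "\<not> len (s i \<otimes> (val xs \<otimes> b)) < len (val xs \<otimes> b)"
      using cocycle[of "s i" "val xs" b] up i v bc t_def by simp
    then have "len (val xs \<otimes> b) < len (s i \<otimes> (val xs \<otimes> b))"
      using len_refl_cases[of "s i" "val xs \<otimes> b"] i v bc by auto
    moreover have "len (s i \<otimes> (val xs \<otimes> b)) \<le> Suc (len (val xs \<otimes> b))"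
      using len_mult[of "s i" "val xs \<otimes> b"] len_s_le[of i] i v bc by simp
    ultimately show ?case using Cons.IH i len v bc by (simp add: m_assoc)
  qed (use bc in auto)
  then show ?thesis using parabolic_reduced_word[OF J u] by metis
qed

lemma len_min_reps:
  assumes J: "J \<subseteq> ix" and w: "w \<in> min_reps W J" and u: "u \<in> parabolic W J"
  shows "len (w \<otimes> u) = len w + len u"
proof -
  have c: "w \<in> carrier W" "u \<in> carrier W" using w u parabolic_closed[OF J] by (auto simp: min_reps_def)
  have "len (inv u \<otimes> inv w) = len (inv u) + len (inv w)"
    using inv_in_left_min[OF J c(1)] w u parabolic_inv[OF J] by (intro len_left_min[OF J]) auto
  then show ?thesis using c len_inv[of "w \<otimes> u"] by (simp add: inv_mult_group)
qed

lemma left_min_decomp: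
  assumes J: "J \<subseteq> ix" and x: "x \<in> carrier W"
  obtains a b where "a \<in> parabolic W J" "b \<in> left_min J" "x = a \<otimes> b"
proof -
  obtain u where u: "u \<in> parabolic W J"
    and min: "\<And>v. v \<in> parabolic W J \<Longrightarrow> len (u \<otimes> x) \<le> len (v \<otimes> x)"
    using ex_has_least_nat[of "\<lambda>u. u \<in> parabolic W J" \<one> "\<lambda>u. len (u \<otimes> x)"] parabolic_one[OF J]
    by blast
  have uc: "u \<in> carrier W" using u parabolic_closed[OF J] by blast
  have "len (u \<otimes> x) \<le> len (v \<otimes> (u \<otimes> x))" if "v \<in> parabolic W J" for v
    using min[OF parabolic_mult[OF J that u]] parabolic_closed[OF J that] uc x by (simp add: m_assoc)
  then have "u \<otimes> x \<in> left_min J" using uc x by (simp add: left_min_def)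
  then show ?thesis
    using that[of "inv u" "u \<otimes> x"] u uc x parabolic_inv[OF J] by simp
qed

text \<open>The two representatives differ by some \<open>u\<close> in the parabolic subgroup, and
  additivity of length in both directions forces \<open>u\<close> to have length 0.\<close>

lemma left_min_unique:
  assumes J: "J \<subseteq> ix" and "a \<in> parabolic W J" "b \<in> left_min J" "a' \<in> parabolic W J" "b' \<in> left_min J"
    and eq: "a \<otimes> b = a' \<otimes> b'"
  shows "a = a' \<and> b = b'"
proof -
  have c: "a \<in> carrier W" "a' \<in> carrier W" "b \<in> carrier W" "b' \<in> carrier W"
    using assms parabolic_closed left_min_closed by auto
  define u where "u = inv a' \<otimes> a"
  have u: "u \<in> parabolic W J" unfolding u_def using assms by (intro parabolic_mult parabolic_inv)
  have uc: "u \<in> carrier W" using c by (simp add: u_def)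
  have b': "b' = u \<otimes> b" using c eq by (simp add: u_def m_assoc)
  then have "b = inv u \<otimes> b'" using c uc by simp
  then have "len b = len u + len b'"
    using len_left_min[OF J assms(5) parabolic_inv[OF J u]] uc by simp
  moreover have "len b' = len u + len b" using len_left_min[OF J assms(3) u] b' by simp
  ultimately have "u = \<one>" using len_eq_0[OF uc] by simp
  moreover have "a = a' \<otimes> u" using c by (simp add: u_def)
  ultimately show ?thesis using b' c by simp
qed

text \<open>The reflection is absorbed by \<open>a\<close>, and in the additive lengths the term
  \<open>len b\<close> cancels.\<close>

lemma len_refl_decomp_in:
  assumes J: "J \<subseteq> ix" and "a \<in> parabolic W J" "b \<in> left_min J" "t \<in> parabolic W J"
  shows "len (a \<otimes> b) < len (t \<otimes> (a \<otimes> b)) \<longleftrightarrow> len a < len (t \<otimes> a)"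
proof -
  have "t \<otimes> (a \<otimes> b) = (t \<otimes> a) \<otimes> b"
    using assms parabolic_closed left_min_closed by (simp add: m_assoc)
  then show ?thesis
    using len_left_min[OF J assms(3)] assms(2,4) parabolic_mult[OF J] by simp
qed

lemma refl_descent_left_min:
  assumes J: "J \<subseteq> ix" and b: "b \<in> left_min J" and "len (t \<otimes> b) < len b"
  shows "t \<notin> parabolic W J"
  using assms by (auto simp: left_min_def not_less[symmetric])

lemma conj_parabolic_iff:
  assumes J: "J \<subseteq> ix" and a: "a \<in> parabolic W J" and t: "t \<in> carrier W"
  shows "inv a \<otimes> t \<otimes> a \<in> parabolic W J \<longleftrightarrow> t \<in> parabolic W J"
proof
  have ac: "a \<in> carrier W" using a parabolic_closed[OF J] by blast
  assume "inv a \<otimes> t \<otimes> a \<in> parabolic W J"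
  then have "a \<otimes> (inv a \<otimes> t \<otimes> a) \<otimes> inv a \<in> parabolic W J"
    using parabolic_mult[OF J parabolic_mult[OF J a] parabolic_inv[OF J a]] by blast
  then show "t \<in> parabolic W J" using ac t by (simp add: m_assoc)
qed (use a J in \<open>auto intro: parabolic_mult parabolic_inv\<close>)

text \<open>A reflection shortening \<open>a\<close> would lie in the parabolic subgroup, so only
  the contribution of \<open>b\<close> remains in the cocycle identity.\<close>

lemma len_refl_decomp_notin:
  assumes J: "J \<subseteq> ix" and a: "a \<in> parabolic W J" and b: "b \<in> left_min J"
    and t: "t \<in> refls" "t \<notin> parabolic W J"
  shows "len (t \<otimes> (a \<otimes> b)) < len (a \<otimes> b) \<longleftrightarrow> len (inv a \<otimes> t \<otimes> a \<otimes> b) < len b"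
  using cocycle[OF t(1), of a b] refl_descent_parabolic[OF J a t(1)] t(2)
    parabolic_closed[OF J a] left_min_closed[OF b] by blast

section \<open>Bruhat order and twisted orders\<close>

lemma root_refl_act: "x \<in> carrier W \<Longrightarrow> i \<in> ix \<Longrightarrow> root_refl W (act x (basis_vec i)) = rfl x i"
  unfolding root_refl_def by (rule the_equality; use rfl_unique in metis)

lemma real_roots_iff: "b \<in> real_roots W \<longleftrightarrow> (\<exists>x\<in>carrier W. \<exists>i\<in>ix. b = act x (basis_vec i))"
  by (auto simp: roots_of_def parabolic_def generated[symmetric])

text \<open>A reflection determines its root up to sign, and reflections in the parabolic subgroup
  are conjugates of its simple reflections inside that subgroup.\<close>

lemma roots_of_iff:
  assumes J: "J \<subseteq> ix" and x: "x \<in> carrier W" "i \<in> ix"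
  shows "act x (basis_vec i) \<in> roots_of W J \<longleftrightarrow> rfl x i \<in> parabolic W J"
proof
  assume "act x (basis_vec i) \<in> roots_of W J"
  then obtain u j where u: "u \<in> parabolic W J" "j \<in> J" "act x (basis_vec i) = act u (basis_vec j)"
    by (auto simp: roots_of_def)
  then have "rfl x i = rfl u j"
    using rfl_unique[of u j x i] x J parabolic_closed by auto
  then show "rfl x i \<in> parabolic W J"
    using u J by (auto intro!: parabolic_mult parabolic_inv parabolic_s)
next
  assume "rfl x i \<in> parabolic W J"
  then obtain u j where u: "u \<in> parabolic W J" "j \<in> J" "rfl x i = rfl u j"
    using refl_in_parabolic[OF J rfl_in_refls[OF x]] by metis
  have uc: "u \<in> carrier W" "j \<in> ix" using u J parabolic_closed by auto
  define b where "b = act x (basis_vec i)"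
  define g where "g = act u (basis_vec j)"
  have keys: "keys b \<subseteq> ix" "keys g \<subseteq> ix"
    using keys_act[of x "basis_vec i"] keys_act[of u "basis_vec j"] x uc by (auto simp: b_def g_def)
  have one: "B b b = 1" "B g g = 1"
    using B_act[of x "basis_vec i" "basis_vec i"] B_act[of u "basis_vec j" "basis_vec j"] x uc
    by (auto simp: b_def g_def cox_form_basis cox_coeff_same)
  define c where "c = B g b"
  \<comment> \<open>The common reflection is evaluated at \<open>b\<close>, once by the formula for
    the root \<open>g\<close> and once by that for \<open>b\<close>.\<close>
  have "b - scl (2 * c) g = b - scl 2 b"
    using act_rfl[OF x keys(1)] act_rfl[OF uc keys(1)] u(3) one
    by (simp add: b_def[symmetric] g_def[symmetric] c_def)
  then have "scl (1 / 2) (scl (2 * c) g) = scl (1 / 2) (scl 2 b)" by simp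
  then have b: "b = scl c g" by simp
  then have "c\<^sup>2 = 1" using one by (simp add: cox_form_linear power2_eq_square)
  then have "b = g \<or> b = - g" using b by (auto simp: power2_eq_1_iff)
  moreover have "g \<in> roots_of W J" using u by (auto simp: roots_of_def g_def)
  moreover have "- g \<in> roots_of W J"
  proof -
    have "- g = act (u \<otimes> s j) (basis_vec j)" using uc by (simp add: g_def act_mult_s)
    moreover have "u \<otimes> s j \<in> parabolic W J" using u J by (intro parabolic_mult parabolic_s)
    ultimately show ?thesis using u(2) unfolding roots_of_def by blast
  qed
  ultimately show "act x (basis_vec i) \<in> roots_of W J" by (auto simp: b_def)
qed

section \<open>The twisted order in terms of lengths\<close>

text \<open>This is the generating relation with the roots eliminated. Of the two roots of
  \<open>t\<close> exactly one is twisted positive; it is negative in the usual sense exactly when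
  \<open>t\<close> lies in the parabolic subgroup, which reverses the comparison of lengths.\<close>

definition twisted_step :: "'i set \<Rightarrow> 'g \<Rightarrow> 'g \<Rightarrow> bool" where
  "twisted_step J u w \<longleftrightarrow> w \<in> carrier W \<and> (\<exists>t\<in>refls. u = t \<otimes> w \<and>
     (if t \<in> parabolic W J then len w < len (t \<otimes> w) else len (t \<otimes> w) < len w))"

lemma pos_roots_iff: "b \<in> pos_roots W \<longleftrightarrow> b \<in> real_roots W \<and> nonneg b"
  by (simp add: pos_roots_def nonneg_def)

lemma neg_roots_iff: "b \<in> neg_roots W \<longleftrightarrow> b \<in> real_roots W \<and> nonneg (- b)"
  by (simp add: neg_roots_def nonneg_def)

lemma twisted_step_roots:
  assumes J: "J \<subseteq> ix"
  shows "twisted_step J u w \<longleftrightarrow> w \<in> carrier W \<and> (\<exists>b\<in>twisted_pos W J.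
    act (inv w) b \<in> neg_roots W \<and> u = root_refl W b \<otimes> w)"
proof (cases "w \<in> carrier W")
  case w: True
  have act_root: "act (inv w) (act x (basis_vec i)) \<in> real_roots W" if "x \<in> carrier W" "i \<in> ix" for x i
    using that w by (auto simp: real_roots_iff act_mult[symmetric] intro!: bexI[of _ "inv w \<otimes> x"])
  have neg: "act (inv w) (act x (basis_vec i)) \<in> neg_roots W \<longleftrightarrow>
      \<not> nonneg (act (inv w) (act x (basis_vec i)))" if "x \<in> carrier W" "i \<in> ix" for x i
    using that w act_root root_sign[of "inv w \<otimes> x" i] by (simp add: neg_roots_iff act_mult)
  have tw: "act x (basis_vec i) \<in> twisted_pos W J \<longleftrightarrow>
      (nonneg (act x (basis_vec i)) \<longleftrightarrow> rfl x i \<notin> parabolic W J)"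
    if "x \<in> carrier W" "i \<in> ix" for x i
  proof -
    have "act x (basis_vec i) \<in> real_roots W" using that by (auto simp: real_roots_iff)
    then show ?thesis
      using that roots_of_iff[OF J, of x i] root_sign[of x i]
      by (auto simp: twisted_pos_def pos_roots_iff neg_roots_iff)
  qed
  have step: "(if t \<in> parabolic W J then len w < len (t \<otimes> w) else len (t \<otimes> w) < len w) \<longleftrightarrow>
      act x (basis_vec i) \<in> twisted_pos W J \<and> act (inv w) (act x (basis_vec i)) \<in> neg_roots W"
    if x: "x \<in> carrier W" "i \<in> ix" "t = rfl x i"
      and sign: "nonneg (act x (basis_vec i)) \<longleftrightarrow> rfl x i \<notin> parabolic W J" for x i t
  proof (cases "nonneg (act x (basis_vec i))")
    case True
    then show ?thesis
      using neg[OF x(1,2)] tw[OF x(1,2)] len_rfl_mult[OF x(1,2) True w] sign x(3) by simp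
  next
    case False
    have y: "x \<otimes> s i \<in> carrier W" "nonneg (act (x \<otimes> s i) (basis_vec i))"
      using x False root_sign[of x i] by (auto simp: act_mult_s)
    have eq: "rfl (x \<otimes> s i) i = rfl x i"
      using rfl_unique[of x i "x \<otimes> s i" i] x by (simp add: act_mult_s)
    have "nonneg (act (inv w) (act (x \<otimes> s i) (basis_vec i))) \<longleftrightarrow>
        \<not> nonneg (act (inv w) (act x (basis_vec i)))"
      using root_sign[of "inv w \<otimes> x" i] x w
      by (simp add: act_mult_s[OF x(1,2)] act_uminus act_mult[of "inv w" x])
    then show ?thesis
      using neg[OF x(1,2)] tw[OF x(1,2)] len_rfl_mult[OF y(1) x(2) y(2) w] sign x(3) False eq by simp
  qed
  show ?thesis
  proof
    assume "twisted_step J u w"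
    then obtain t where t: "t \<in> refls" "u = t \<otimes> w"
      "if t \<in> parabolic W J then len w < len (t \<otimes> w) else len (t \<otimes> w) < len w"
      by (auto simp: twisted_step_def)
    obtain x i where x: "x \<in> carrier W" "i \<in> ix" "t = rfl x i" "nonneg (act x (basis_vec i))"
      using t rfl_cases by blast
    \<comment> \<open>\<open>y\<close> picks, among the two opposite roots of \<open>t\<close>, the
      twisted positive one.\<close>
    define y where "y = (if t \<in> parabolic W J then x \<otimes> s i else x)"
    have y: "y \<in> carrier W" using x by (simp add: y_def)
    have ty: "t = rfl y i"
      using rfl_unique[of x i "x \<otimes> s i" i] x by (simp add: y_def act_mult_s)
    have "nonneg (act y (basis_vec i)) \<longleftrightarrow> t \<notin> parabolic W J"
      using x root_sign[of x i] by (simp add: y_def act_mult_s)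
    then have "act y (basis_vec i) \<in> twisted_pos W J \<and> act (inv w) (act y (basis_vec i)) \<in> neg_roots W"
      using step[OF y x(2) ty] t(3) ty by simp
    then show "w \<in> carrier W \<and> (\<exists>b\<in>twisted_pos W J.
        act (inv w) b \<in> neg_roots W \<and> u = root_refl W b \<otimes> w)"
      using w t(2) ty root_refl_act[OF y x(2)] by auto
  next
    assume "w \<in> carrier W \<and> (\<exists>b\<in>twisted_pos W J.
        act (inv w) b \<in> neg_roots W \<and> u = root_refl W b \<otimes> w)"
    then obtain b where b: "b \<in> twisted_pos W J" "act (inv w) b \<in> neg_roots W"
      "u = root_refl W b \<otimes> w" by blast
    then have "b \<in> real_roots W"
      by (auto simp: twisted_pos_def pos_roots_def neg_roots_def)
    then obtain x i where x: "x \<in> carrier W" "i \<in> ix" "b = act x (basis_vec i)"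
      by (auto simp: real_roots_iff)
    then show "twisted_step J u w"
      unfolding twisted_step_def
      using step[OF x(1,2) refl] tw[OF x(1,2)] b w rfl_in_refls[OF x(1,2)] root_refl_act[OF x(1,2)]
      by (intro conjI bexI[of _ "rfl x i"]) auto
  qed
qed (simp add: twisted_step_def)

lemma twisted_le_iff:
  "J \<subseteq> ix \<Longrightarrow> twisted_le W J x y \<longleftrightarrow>
    x \<in> carrier W \<and> y \<in> carrier W \<and> (twisted_step J)\<^sup>*\<^sup>* x y"
  unfolding twisted_le_def by (subst twisted_step_roots[symmetric]) simp_all

section \<open>Bruhat order and lifting properties\<close>

definition bruhat_step :: "'g \<Rightarrow> 'g \<Rightarrow> bool" where
  "bruhat_step u v \<longleftrightarrow> u \<in> carrier W \<and> (\<exists>t\<in>refls. v = t \<otimes> u) \<and> len u < len v"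

lemma bruhat_le_iff:
  "bruhat_le W x y \<longleftrightarrow> x \<in> carrier W \<and> y \<in> carrier W \<and> bruhat_step\<^sup>*\<^sup>* x y"
  by (simp add: bruhat_le_def bruhat_step_def[abs_def])

lemma bruhat_step_closed: "bruhat_step u v \<Longrightarrow> u \<in> carrier W \<and> v \<in> carrier W"
  by (auto simp: bruhat_step_def)

lemma twisted_step_closed: "twisted_step J u v \<Longrightarrow> u \<in> carrier W \<and> v \<in> carrier W"
  by (auto simp: twisted_step_def)

text \<open>Multiplication by \<open>s i\<close> on the right preserves whether the left reflection
  \<open>t\<close> shortens, except for the single \<open>t\<close> with
  \<open>t \<otimes> x = x \<otimes> s i\<close>, which gives the first alternative.\<close>

lemma bruhat_step_mult_s:
  assumes "bruhat_step x z" "i \<in> ix"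
  shows "z = x \<otimes> s i \<or> bruhat_step (x \<otimes> s i) (z \<otimes> s i)"
proof -
  obtain t where t: "t \<in> refls" "z = t \<otimes> x" "x \<in> carrier W" "len x < len (t \<otimes> x)"
    using assms by (auto simp: bruhat_step_def)
  have "bruhat_step (x \<otimes> s i) (z \<otimes> s i)" if "t \<otimes> x \<noteq> x \<otimes> s i"
  proof -
    have "len (x \<otimes> s i) < len (t \<otimes> (x \<otimes> s i))"
      using refl_descent_mult_s[OF t(1,3) assms(2) that] len_refl_cases[OF t(1), of "x \<otimes> s i"] t assms(2)
      by auto
    then show ?thesis
      unfolding bruhat_step_def using t assms(2) by (auto simp: m_assoc)
  qed
  then show ?thesis using t by blast
qed

text \<open>The left reflection is kept, and with it its membership in the parabolic subgroup, so
  the argument for the Bruhat order carries over.\<close>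

lemma twisted_step_mult_s:
  assumes "twisted_step J x z" "i \<in> ix"
  shows "z = x \<otimes> s i \<or> twisted_step J (x \<otimes> s i) (z \<otimes> s i)"
proof -
  obtain t where t: "t \<in> refls" "x = t \<otimes> z" "z \<in> carrier W"
    "if t \<in> parabolic W J then len z < len (t \<otimes> z) else len (t \<otimes> z) < len z"
    using assms by (auto simp: twisted_step_def)
  have "twisted_step J (x \<otimes> s i) (z \<otimes> s i)" if ne: "t \<otimes> z \<noteq> z \<otimes> s i"
  proof -
    have "len (t \<otimes> (z \<otimes> s i)) < len (z \<otimes> s i) \<longleftrightarrow> len (t \<otimes> z) < len z"
      by (rule refl_descent_mult_s[OF t(1,3) assms(2) ne])
    then have "if t \<in> parabolic W J then len (z \<otimes> s i) < len (t \<otimes> (z \<otimes> s i))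
        else len (t \<otimes> (z \<otimes> s i)) < len (z \<otimes> s i)"
      using len_refl_cases[OF t(1), of "z \<otimes> s i"] t(3,4) assms(2) by (auto split: if_splits)
    then show ?thesis
      unfolding twisted_step_def using t assms(2) by (auto simp: m_assoc)
  qed
  moreover have "z = x \<otimes> s i" if "t \<otimes> z = z \<otimes> s i"
    using that t assms(2) by simp
  ultimately show ?thesis by blast
qed

text \<open>The lifting property is stated for any relation with the step property above, so that it
  serves both orders. Multiply the chain by \<open>s i\<close> step by step; at an exceptional step
  the new chain meets the old one, which is followed from there on. \<open>lift_down\<close> reads
  the chain from its other end.\<close>

lemma
  assumes step: "\<And>x z. R x z \<Longrightarrow> z = x \<otimes> s i \<or> R (x \<otimes> s i) (z \<otimes> s i)"
    and closed: "\<And>x z. R x z \<Longrightarrow> x \<in> carrier W \<and> z \<in> carrier W"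
    and i: "i \<in> ix" and le: "R\<^sup>*\<^sup>* x z"
  shows lift_up: "R\<^sup>*\<^sup>* (x \<otimes> s i) (z \<otimes> s i) \<or> R\<^sup>*\<^sup>* (x \<otimes> s i) z"
    and lift_down: "R\<^sup>*\<^sup>* (x \<otimes> s i) (z \<otimes> s i) \<or> R\<^sup>*\<^sup>* x (z \<otimes> s i)"
proof -
  show "R\<^sup>*\<^sup>* (x \<otimes> s i) (z \<otimes> s i) \<or> R\<^sup>*\<^sup>* (x \<otimes> s i) z"
    using le
  proof (induction rule: rtranclp_induct)
    case (step y z)
    then show ?case
      using assms(1)[OF step(2)] by (metis rtranclp.rtrancl_into_rtrancl)
  qed simp
  show "R\<^sup>*\<^sup>* (x \<otimes> s i) (z \<otimes> s i) \<or> R\<^sup>*\<^sup>* x (z \<otimes> s i)"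
    using le
  proof (induction rule: converse_rtranclp_induct)
    case (step x y)
    show ?case
    proof (cases "y = x \<otimes> s i")
      case True
      then have "x = y \<otimes> s i" using closed[OF step(1)] i by simp
      then show ?thesis using step by (metis converse_rtranclp_into_rtranclp)
    next
      case False
      then show ?thesis
        using assms(1)[OF step(1)] step by (metis converse_rtranclp_into_rtranclp)
    qed
  qed simp
qed

lemma bruhat_lift_up:
  "bruhat_le W x z \<Longrightarrow> i \<in> ix \<Longrightarrow> bruhat_le W (x \<otimes> s i) (z \<otimes> s i) \<or> bruhat_le W (x \<otimes> s i) z"
  using lift_up[of bruhat_step i x z] bruhat_step_mult_s bruhat_step_closed
  by (auto simp: bruhat_le_iff)

lemma bruhat_lift_down:
  "bruhat_le W x z \<Longrightarrow> i \<in> ix \<Longrightarrow> bruhat_le W (x \<otimes> s i) (z \<otimes> s i) \<or> bruhat_le W x (z \<otimes> s i)"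
  using lift_down[of bruhat_step i x z] bruhat_step_mult_s bruhat_step_closed
  by (auto simp: bruhat_le_iff)

lemma twisted_lift_up:
  "J \<subseteq> ix \<Longrightarrow> twisted_le W J x z \<Longrightarrow> i \<in> ix \<Longrightarrow>
    twisted_le W J (x \<otimes> s i) (z \<otimes> s i) \<or> twisted_le W J (x \<otimes> s i) z"
  using lift_up[of "twisted_step J" i x z] twisted_step_mult_s twisted_step_closed
  by (auto simp: twisted_le_iff)

lemma bruhat_refl: "x \<in> carrier W \<Longrightarrow> bruhat_le W x x"
  by (simp add: bruhat_le_iff)

lemma bruhat_trans: "bruhat_le W x y \<Longrightarrow> bruhat_le W y z \<Longrightarrow> bruhat_le W x z"
  by (auto simp: bruhat_le_iff)

lemma bruhat_le_len: "bruhat_le W x y \<Longrightarrow> x = y \<or> len x < len y"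
proof -
  have "bruhat_step\<^sup>*\<^sup>* x y \<Longrightarrow> x = y \<or> len x < len y"
    by (induction rule: rtranclp_induct) (auto simp: bruhat_step_def)
  then show "bruhat_le W x y \<Longrightarrow> x = y \<or> len x < len y" by (simp add: bruhat_le_iff)
qed

lemma bruhat_step_le: "bruhat_step x y \<Longrightarrow> bruhat_le W x y"
  using bruhat_step_closed by (simp add: bruhat_le_iff r_into_rtranclp)

lemma bruhat_le_refl_mult:
  "t \<in> refls \<Longrightarrow> x \<in> carrier W \<Longrightarrow> len x < len (t \<otimes> x) \<Longrightarrow> bruhat_le W x (t \<otimes> x)"
  by (intro bruhat_step_le) (auto simp: bruhat_step_def)

lemma bruhat_le_mult_refl:
  assumes "t \<in> refls" "x \<in> carrier W" "len x < len (x \<otimes> t)"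
  shows "bruhat_le W x (x \<otimes> t)"
proof -
  have "x \<otimes> t = (x \<otimes> t \<otimes> inv x) \<otimes> x" using assms by (simp add: m_assoc)
  then show ?thesis
    using bruhat_le_refl_mult[OF refls_conj[OF assms(1,2)] assms(2)] assms(3) by simp
qed

lemma bruhat_inv: assumes "bruhat_le W x y" shows "bruhat_le W (inv x) (inv y)"
proof -
  have "bruhat_step\<^sup>*\<^sup>* x y \<Longrightarrow> x \<in> carrier W \<Longrightarrow> bruhat_le W (inv x) (inv y)"
  proof (induction rule: rtranclp_induct)
    case (step y z)
    then obtain t where t: "t \<in> refls" "z = t \<otimes> y" "y \<in> carrier W" "len y < len (t \<otimes> y)"
      by (auto simp: bruhat_step_def)
    then have "inv z = inv y \<otimes> t" by (simp add: inv_mult_group)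
    moreover have "len (inv y) < len (inv y \<otimes> t)"
      using t len_inv[of "t \<otimes> y"] by (simp add: inv_mult_group)
    ultimately have "bruhat_le W (inv y) (inv z)"
      using bruhat_le_mult_refl[OF t(1), of "inv y"] t(3) by simp
    then show ?case using step bruhat_trans by blast
  qed (simp add: bruhat_refl)
  then show ?thesis using assms by (simp add: bruhat_le_iff)
qed


lemma parabolic_induct [consumes 2, case_names one mult_s]:
  assumes J: "J \<subseteq> ix" and u: "u \<in> parabolic W J"
    and one: "P \<one>"
    and step: "\<And>u k. u \<in> parabolic W J \<Longrightarrow> k \<in> J \<Longrightarrow> len u < len (u \<otimes> s k) \<Longrightarrow> P u \<Longrightarrow> P (u \<otimes> s k)"
  shows "P u"
proof -
  have "P (val xs)" if "xs \<in> lists J" "length xs = len (val xs)" for xs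
    using that
  proof (induction xs rule: rev_induct)
    case (snoc k xs)
    then have k: "k \<in> J" "k \<in> ix" "xs \<in> lists J" "xs \<in> lists ix" using J by auto
    then have val: "val (xs @ [k]) = val xs \<otimes> s k" by (simp add: val_append)
    then have "Suc (length xs) \<le> Suc (len (val xs))"
      using snoc.prems(2) len_mult_s(1)[of "val xs" k] k by simp
    then have "length xs = len (val xs)" using len_val_le[of xs] k by simp
    then show ?case
      unfolding val using snoc.prems(2) snoc.IH k J val by (intro step parabolic_val) auto
  qed (simp add: one)
  then show ?thesis using parabolic_reduced_word[OF J u] by metis
qed

lemma s_inj: "i \<in> ix \<Longrightarrow> j \<in> ix \<Longrightarrow> s i = s j \<Longrightarrow> i = j"
proof (rule ccontr)
  assume *: "i \<in> ix" "j \<in> ix" "s i = s j" "i \<noteq> j"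
  have "lookup (act (s i) (basis_vec i)) i = - 1"
    by (simp only: act_s[OF *(1)] geom_refl_basis_same[OF *(1)]) simp
  moreover have "lookup (act (s j) (basis_vec i)) i = 1"
    using * by (simp add: act_s geom_refl_basis lookup_minus lookup_single when_def)
  ultimately show False using *(3) by simp
qed

lemma s_in_parabolic:
  assumes J: "J \<subseteq> ix" and i: "i \<in> ix" and s: "s i \<in> parabolic W J"
  shows "i \<in> J"
proof -
  obtain xs where xs: "xs \<in> lists J" "val xs = s i" "length xs = 1"
    using parabolic_reduced_word[OF J s] len_s[OF i] by metis
  then obtain j where "xs = [j]" by (metis One_nat_def length_0_conv length_Suc_conv)
  then show ?thesis using xs s_inj[OF i, of j] J by auto
qed

text \<open>Minimality can be tested on simple reflections: if the parabolic factor of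
  \<open>b\<close> were nontrivial, the first letter of its reduced word would shorten
  \<open>b\<close>.\<close>

lemma left_minI:
  assumes J: "J \<subseteq> ix" and b: "b \<in> carrier W"
    and no_descent: "\<And>j. j \<in> J \<Longrightarrow> \<not> len (s j \<otimes> b) < len b"
  shows "b \<in> left_min J"
proof -
  obtain a c where ac: "a \<in> parabolic W J" "c \<in> left_min J" "b = a \<otimes> c"
    using left_min_decomp[OF J b] by blast
  have cc: "c \<in> carrier W" using ac left_min_closed by blast
  obtain xs where xs: "xs \<in> lists J" "val xs = a" "length xs = len a"
    using parabolic_reduced_word[OF J ac(1)] by blast
  have "a = \<one>"
  proof (cases xs)
    case (Cons j ys)
    then have j: "j \<in> J" "j \<in> ix" "ys \<in> lists J" "ys \<in> lists ix" using xs J by auto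
    have "b = s j \<otimes> (val ys \<otimes> c)"
      using ac(3) xs(2)[symmetric] Cons j cc by (simp add: m_assoc)
    then have "s j \<otimes> b = val ys \<otimes> c"
      using j cc by simp
    then have "len (s j \<otimes> b) = len (val ys) + len c"
      using len_left_min[OF J ac(2) parabolic_val[OF J j(3)]] by simp
    also have "\<dots> < len a + len c"
      using len_val_le[of ys] j xs(3) Cons by simp
    also have "\<dots> = len b" using len_left_min[OF J ac(2,1)] ac(3) by simp
    finally show ?thesis using no_descent j(1) by blast
  qed (use xs in simp)
  then show ?thesis using ac cc by simp
qed

section \<open>Antisymmetry of the twisted order\<close>

text \<open>The length of the minimal representative of the coset of \<open>x\<close>. It is the
  first component of the lexicographic rank behind antisymmetry.\<close>

definition coset_len :: "'i set \<Rightarrow> 'g \<Rightarrow> nat" where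
  "coset_len J x = (LEAST n. \<exists>u\<in>parabolic W J. len (u \<otimes> x) = n)"

lemma coset_len_le: "u \<in> parabolic W J \<Longrightarrow> coset_len J x \<le> len (u \<otimes> x)"
  unfolding coset_len_def by (rule Least_le) auto

lemma coset_len_attained:
  assumes "J \<subseteq> ix"
  obtains u where "u \<in> parabolic W J" "len (u \<otimes> x) = coset_len J x"
proof -
  have "\<exists>u\<in>parabolic W J. len (u \<otimes> x) = coset_len J x"
    unfolding coset_len_def by (rule LeastI_ex) (use parabolic_one[OF assms] in blast)
  then show ?thesis using that by blast
qed

lemma coset_len_mult_le:
  assumes J: "J \<subseteq> ix" and t: "t \<in> parabolic W J" and x: "x \<in> carrier W"
  shows "coset_len J (t \<otimes> x) \<le> coset_len J x"
proof -
  obtain u where u: "u \<in> parabolic W J" "len (u \<otimes> x) = coset_len J x"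
    using coset_len_attained[OF J] by blast
  have "(u \<otimes> inv t) \<otimes> (t \<otimes> x) = u \<otimes> x"
    using u(1) t x parabolic_closed[OF J] by (simp add: m_assoc)
  then show ?thesis
    using coset_len_le[OF parabolic_mult[OF J u(1) parabolic_inv[OF J t]], of "t \<otimes> x"] u(2) by simp
qed

lemma coset_len_decomp:
  assumes J: "J \<subseteq> ix" and a: "a \<in> parabolic W J" and b: "b \<in> left_min J"
  shows "coset_len J (a \<otimes> b) = len b"
proof (rule antisym)
  have c: "a \<in> carrier W" "b \<in> carrier W" using a b parabolic_closed[OF J] left_min_closed by auto
  show "coset_len J (a \<otimes> b) \<le> len b"
    using coset_len_le[OF parabolic_inv[OF J a], of "a \<otimes> b"] c by simp
  obtain u where u: "u \<in> parabolic W J" "len (u \<otimes> (a \<otimes> b)) = coset_len J (a \<otimes> b)"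
    using coset_len_attained[OF J] by blast
  have "len (u \<otimes> a \<otimes> b) = len (u \<otimes> a) + len b"
    using u a by (intro len_left_min[OF J b] parabolic_mult[OF J])
  then show "len b \<le> coset_len J (a \<otimes> b)"
    using u c parabolic_closed[OF J] by (simp add: m_assoc)
qed

text \<open>A reflection in the parabolic subgroup stays in the coset and makes the lower element
  longer. Any other one replaces the minimal factor \<open>b\<close> by something shorter, which
  bounds the length of the new minimal representative.\<close>

lemma twisted_step_lex:
  assumes J: "J \<subseteq> ix" and step: "twisted_step J y x"
  shows "coset_len J y < coset_len J x \<or> coset_len J y = coset_len J x \<and> len x < len y"
proof -
  obtain t where t: "t \<in> refls" "y = t \<otimes> x" "x \<in> carrier W"
    "if t \<in> parabolic W J then len x < len (t \<otimes> x) else len (t \<otimes> x) < len x"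
    using step by (auto simp: twisted_step_def)
  show ?thesis
  proof (cases "t \<in> parabolic W J")
    case True
    then have "coset_len J y = coset_len J x"
      using coset_len_mult_le[OF J True t(3)] coset_len_mult_le[OF J True, of y] t(1-3) by simp
    then show ?thesis using t True by simp
  next
    case False
    obtain a b where ab: "a \<in> parabolic W J" "b \<in> left_min J" "x = a \<otimes> b"
      using left_min_decomp[OF J t(3)] by blast
    have c: "a \<in> carrier W" "b \<in> carrier W" using ab parabolic_closed[OF J] left_min_closed by auto
    have "len (inv a \<otimes> t \<otimes> a \<otimes> b) < len b"
      using len_refl_decomp_notin[OF J ab(1,2) t(1) False] t(4) False ab(3) by simp
    moreover have "coset_len J y \<le> len (inv a \<otimes> t \<otimes> a \<otimes> b)"
      using coset_len_le[OF parabolic_inv[OF J ab(1)], of y] t(1,2) ab(3) c by (simp add: m_assoc)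
    ultimately show ?thesis using coset_len_decomp[OF J ab(1,2)] ab(3) by simp
  qed
qed

lemma twisted_refl: "J \<subseteq> ix \<Longrightarrow> x \<in> carrier W \<Longrightarrow> twisted_le W J x x"
  by (simp add: twisted_le_iff)

lemma twisted_trans: "J \<subseteq> ix \<Longrightarrow> twisted_le W J x y \<Longrightarrow> twisted_le W J y z \<Longrightarrow> twisted_le W J x z"
  by (auto simp: twisted_le_iff)

lemma twisted_antisym:
  assumes J: "J \<subseteq> ix" and "twisted_le W J x y" "twisted_le W J y x"
  shows "x = y"
proof -
  have "(twisted_step J)\<^sup>*\<^sup>* x y \<Longrightarrow>
    x = y \<or> coset_len J x < coset_len J y \<or> coset_len J x = coset_len J y \<and> len y < len x" for x y
    by (induction rule: rtranclp_induct) (use twisted_step_lex[OF J] in fastforce)+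
  from this[of x y] this[of y x] assms show ?thesis by (auto simp: twisted_le_iff)
qed

lemma poset_twisted: "J \<subseteq> ix \<Longrightarrow> poset_on (carrier W) (twisted_le W J)"
  unfolding poset_on_def
  by (auto intro!: reflp_onI transp_onI antisymp_onI twisted_refl
      intro: twisted_antisym dest: twisted_trans)

section \<open>Bruhat order and cosets\<close>

text \<open>Let \<open>u\<close> grow by one letter \<open>k\<close> at a time. Lengths over the
  minimal \<open>w\<close> add up, hence \<open>w u < w u s_k\<close>, and with this both
  alternatives of the lifting property give the claim.\<close>

lemma bruhat_mult_min_reps:
  assumes K: "K \<subseteq> ix" and w: "w \<in> min_reps W K" and y: "bruhat_le W y w" and u: "u \<in> parabolic W K"
  shows "bruhat_le W (y \<otimes> u) (w \<otimes> u)"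
  using K u
proof (induction rule: parabolic_induct)
  case one
  then show ?case using y by (simp add: bruhat_le_iff)
next
  case (mult_s u k)
  have k: "k \<in> ix" using mult_s(2) K by auto
  have c: "y \<in> carrier W" "w \<in> carrier W" "u \<in> carrier W"
    using y mult_s(1) parabolic_closed[OF K] by (auto simp: bruhat_le_iff)
  have "len (w \<otimes> (u \<otimes> s k)) = len w + len (u \<otimes> s k)" "len (w \<otimes> u) = len w + len u"
    using mult_s parabolic_s by (intro len_min_reps[OF K w] parabolic_mult[OF K]; simp)+
  then have "bruhat_le W (w \<otimes> u) (w \<otimes> u \<otimes> s k)"
    using mult_s(3) k c by (intro bruhat_le_mult_refl) (auto simp: m_assoc)
  then show ?case
    using bruhat_lift_up[OF mult_s(4) k] bruhat_trans k c by (auto simp: m_assoc)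
qed

text \<open>The element \<open>v\<close> is spelled by a subword of a reduced word for
  \<open>u\<close>: a letter is kept or omitted according to the alternative of the lifting
  property. Since \<open>w\<close> is minimal, the letters omitted keep \<open>w v\<close> below
  \<open>w u\<close>.\<close>

lemma bruhat_mult_parabolic:
  assumes K: "K \<subseteq> ix" and w: "w \<in> min_reps W K" and pq: "bruhat_le W p q" and u: "u \<in> parabolic W K"
  shows "\<exists>v\<in>parabolic W K. bruhat_le W (p \<otimes> u) (q \<otimes> v) \<and> bruhat_le W (w \<otimes> v) (w \<otimes> u)"
  using K u
proof (induction rule: parabolic_induct)
  case one
  have "p \<in> carrier W" "q \<in> carrier W" "w \<in> carrier W"
    using pq w by (auto simp: bruhat_le_iff min_reps_def)
  then show ?case using pq parabolic_one[OF K] bruhat_refl by (intro bexI[of _ \<one>]) auto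
next
  case (mult_s u k)
  then obtain v where v: "v \<in> parabolic W K" "bruhat_le W (p \<otimes> u) (q \<otimes> v)"
    "bruhat_le W (w \<otimes> v) (w \<otimes> u)" by blast
  have k: "k \<in> ix" using mult_s(2) K by auto
  have c: "p \<in> carrier W" "q \<in> carrier W" "w \<in> carrier W" "u \<in> carrier W" "v \<in> carrier W"
    using pq w v(1) mult_s(1) parabolic_closed[OF K] by (auto simp: bruhat_le_iff min_reps_def)
  have "len (w \<otimes> (u \<otimes> s k)) = len w + len (u \<otimes> s k)" "len (w \<otimes> u) = len w + len u"
    using mult_s parabolic_s by (intro len_min_reps[OF K w] parabolic_mult[OF K]; simp)+
  then have wu: "bruhat_le W (w \<otimes> u) (w \<otimes> u \<otimes> s k)"
    using mult_s(3) k c by (intro bruhat_le_mult_refl) (auto simp: m_assoc)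
  from bruhat_lift_up[OF v(2) k] show ?case
  proof
    assume "bruhat_le W (p \<otimes> u \<otimes> s k) (q \<otimes> v)"
    then show ?thesis using v bruhat_trans[OF v(3) wu] c k by (auto simp: m_assoc)
  next
    assume "bruhat_le W (p \<otimes> u \<otimes> s k) (q \<otimes> v \<otimes> s k)"
    moreover have "bruhat_le W (w \<otimes> v \<otimes> s k) (w \<otimes> u \<otimes> s k)"
      using bruhat_lift_up[OF v(3) k] bruhat_trans wu by blast
    moreover have "v \<otimes> s k \<in> parabolic W K"
      using v(1) mult_s(2) parabolic_s by (intro parabolic_mult[OF K])
    ultimately show ?thesis using c k by (intro bexI[of _ "v \<otimes> s k"]) (auto simp: m_assoc)
  qed
qed

end

section \<open>Embeddings of Coxeter systems\<close>

locale coxeter_embedding = W: coxeter_system W + V: coxeter_system V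
  for W :: "('g, 'i, 'y) coxeter_scheme" and V :: "('h, 'j, 'z) coxeter_scheme" +
  fixes f :: "'i \<Rightarrow> 'j"
  assumes inj: "inj_on f (simple_ix W)"
    and f_ix: "f ` simple_ix W \<subseteq> simple_ix V"
    and f_mat: "i \<in> simple_ix W \<Longrightarrow> j \<in> simple_ix W \<Longrightarrow> cox_mat V (f i) (f j) = cox_mat W i j"
begin

abbreviation "h \<equiv> induced_map W V f"

lemma f_closed [simp]: "i \<in> simple_ix W \<Longrightarrow> f i \<in> simple_ix V"
  using f_ix by auto

lemma map_lists: "xs \<in> lists (simple_ix W) \<Longrightarrow> map f xs \<in> lists (simple_ix V)"
  using f_ix by auto

lemma cox_cong_map:
  "cox_cong (simple_ix W) (cox_mat W) xs ys \<Longrightarrow>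
    cox_cong (simple_ix V) (cox_mat V) (map f xs) (map f ys)"
proof (induction rule: cox_cong.induct)
  case (cong_refl xs)
  then show ?case by (intro cox_cong.cong_refl map_lists)
next
  case (cong_relator xs ys i j)
  then have "cox_cong (simple_ix V) (cox_mat V)
      (map f xs @ concat (replicate (cox_mat V (f i) (f j)) [f i, f j]) @ map f ys)
      (map f xs @ map f ys)"
    by (intro cox_cong.cong_relator map_lists) (auto simp: f_mat)
  then show ?case
    using cong_relator by (simp add: map_concat f_mat)
qed (blast intro: cox_cong.cong_sym cox_cong.cong_trans)+

lemma h_val:
  assumes "xs \<in> lists (simple_ix W)"
  shows "h (W.val xs) = V.val (map f xs)"
  unfolding induced_map_def
proof (rule the_equality)
  show "\<exists>ys\<in>lists (simple_ix W). W.val ys = W.val xs \<and> V.val (map f xs) = V.val (map f ys)"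
    using assms by blast
  fix g assume "\<exists>ys\<in>lists (simple_ix W). W.val ys = W.val xs \<and> g = V.val (map f ys)"
  then obtain ys where ys: "ys \<in> lists (simple_ix W)" "W.val ys = W.val xs" "g = V.val (map f ys)"
    by blast
  then have "cox_cong (simple_ix W) (cox_mat W) ys xs" using W.presented assms by blast
  then show "g = V.val (map f xs)"
    using ys(1,3) assms V.presented[OF map_lists map_lists] cox_cong_map by blast
qed

lemma h_closed [simp]: "w \<in> carrier W \<Longrightarrow> h w \<in> carrier V"
  by (erule W.word_cases) (simp add: h_val V.val_closed[OF map_lists])

lemma h_mult:
  assumes "v \<in> carrier W" "w \<in> carrier W"
  shows "h (v \<otimes>\<^bsub>W\<^esub> w) = h v \<otimes>\<^bsub>V\<^esub> h w"
proof -
  obtain xs ys where "xs \<in> lists (simple_ix W)" "ys \<in> lists (simple_ix W)" "v = W.val xs" "w = W.val ys"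
    using assms W.word_cases by metis
  then show ?thesis
    using h_val[of "xs @ ys"] by (simp add: W.val_append V.val_append[OF map_lists map_lists] h_val)
qed

lemma h_one [simp]: "h \<one>\<^bsub>W\<^esub> = \<one>\<^bsub>V\<^esub>"
  using h_val[of "[]"] by simp

lemma h_inv: "w \<in> carrier W \<Longrightarrow> h (inv\<^bsub>W\<^esub> w) = inv\<^bsub>V\<^esub> (h w)"
  by (metis V.inv_equality W.inv_closed W.l_inv h_closed h_mult h_one)

lemma h_s: "i \<in> simple_ix W \<Longrightarrow> h (W.s i) = V.s (f i)"
  using h_val[of "[i]"] by simp

lemma h_parabolic:
  assumes J: "J \<subseteq> simple_ix W"
  shows "h ` parabolic W J = parabolic V (f ` J)"
proof -
  have "h ` parabolic W J = (\<lambda>xs. V.val (map f xs)) ` lists J"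
    unfolding W.parabolic_words[OF J] image_image using J by (intro image_cong h_val) auto
  also have "\<dots> = V.val ` lists (f ` J)" by (simp add: image_image lists_image)
  also have "\<dots> = parabolic V (f ` J)"
    using J f_ix by (intro V.parabolic_words[symmetric]) auto
  finally show ?thesis .
qed

lemma h_image: "h ` carrier W = parabolic V (f ` simple_ix W)"
  using h_parabolic[of "simple_ix W"] W.generated by (simp add: parabolic_def)

lemma h_in_parabolic_ix: "w \<in> carrier W \<Longrightarrow> h w \<in> parabolic V (f ` simple_ix W)"
  using h_image by blast

section \<open>Transport of roots and lengths along an embedding\<close>

text \<open>\<open>y\<close> is \<open>x\<close> relabelled by \<open>f\<close> and extended by
  zero. Being a relation, it requires no construction of a linear map between the two
  spaces.\<close>

definition pushed :: "('i \<Rightarrow>\<^sub>0 real) \<Rightarrow> ('j \<Rightarrow>\<^sub>0 real) \<Rightarrow> bool" where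
  "pushed x y \<longleftrightarrow> keys x \<subseteq> simple_ix W \<and> keys y \<subseteq> f ` simple_ix W \<and>
     (\<forall>k\<in>simple_ix W. lookup y (f k) = lookup x k)"

lemma f_eq_iff: "i \<in> simple_ix W \<Longrightarrow> j \<in> simple_ix W \<Longrightarrow> f i = f j \<longleftrightarrow> i = j"
  using inj by (auto dest: inj_onD)

lemma pushed_form:
  assumes "pushed x y" "i \<in> simple_ix W"
  shows "V.B (basis_vec (f i)) y = W.B (basis_vec i) x"
proof -
  have sub: "keys y \<subseteq> f ` keys x" "keys x \<subseteq> simple_ix W"
    using assms by (auto simp: pushed_def in_keys_iff)
  then have inj': "inj_on f (keys x)" using inj inj_on_subset by blast
  have "V.B (basis_vec (f i)) y = (\<Sum>j\<in>f ` keys x. lookup y j * cox_coeff V (f i) j)"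
    using sub by (subst cox_form_superset[of "{f i}" "f ` keys x"]) auto
  also have "\<dots> = (\<Sum>k\<in>keys x. lookup y (f k) * cox_coeff V (f i) (f k))"
    using inj' by (simp add: sum.reindex)
  also have "\<dots> = (\<Sum>k\<in>keys x. lookup x k * cox_coeff W i k)"
    using assms sub by (intro sum.cong) (auto simp: pushed_def cox_coeff_def f_mat subset_iff)
  also have "\<dots> = W.B (basis_vec i) x"
    by (subst cox_form_superset[of "{i}" "keys x"]) auto
  finally show ?thesis .
qed

lemma pushed_geom_refl:
  assumes "pushed x y" "i \<in> simple_ix W"
  shows "pushed (geom_refl W i x) (geom_refl V (f i) y)"
proof -
  define c where "c = 2 * W.B (basis_vec i) x"
  have "keys (x - Poly_Mapping.single i c) \<subseteq> simple_ix W"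
    "keys (y - Poly_Mapping.single (f i) c) \<subseteq> f ` simple_ix W"
    using assms keys_diff[of x "Poly_Mapping.single i c"]
      keys_diff[of y "Poly_Mapping.single (f i) c"]
    by (fastforce simp: pushed_def split: if_splits)+
  then show ?thesis
    using assms pushed_form[OF assms]
    by (auto simp: pushed_def geom_refl_def c_def lookup_minus lookup_single when_def f_eq_iff)
qed

lemma pushed_act:
  assumes "w \<in> carrier W" "i \<in> simple_ix W"
  shows "pushed (W.act w (basis_vec i)) (V.act (h w) (basis_vec (f i)))"
proof -
  have base: "pushed (basis_vec i) (basis_vec (f i))"
    using assms(2) by (auto simp: pushed_def lookup_single when_def f_eq_iff)
  obtain xs where xs: "xs \<in> lists (simple_ix W)" "w = W.val xs" using assms W.word_cases by blast
  have "pushed (word_act W xs (basis_vec i)) (word_act V (map f xs) (basis_vec (f i)))"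
    using xs(1) base by (induction xs) (auto intro: pushed_geom_refl)
  then show ?thesis
    using xs by (simp add: h_val W.geom_act_val V.geom_act_val[OF map_lists])
qed

lemma pushed_nonneg:
  assumes "pushed x y"
  shows "nonneg y \<longleftrightarrow> nonneg x"
proof
  assume "nonneg y"
  then show "nonneg x"
    using assms unfolding pushed_def nonneg_def
    by (metis in_keys_iff order_refl subsetD)
next
  assume x: "nonneg x"
  have "0 \<le> lookup y k" for k
  proof (cases "k \<in> keys y")
    case True
    then show ?thesis using assms x by (auto simp: pushed_def nonneg_def)
  qed (simp add: in_keys_iff)
  then show "nonneg y" by (simp add: nonneg_def)
qed

text \<open>The last letter of a reduced word corresponds to a root that is positive in
  \<open>W\<close>. The transported root is positive in \<open>V\<close>, so the length rises there
  as well when this letter is added.\<close>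

lemma h_len: "w \<in> carrier W \<Longrightarrow> V.len (h w) = W.len w"
proof (induction "W.len w" arbitrary: w)
  case 0
  then show ?case using W.len_eq_0 by simp
next
  case (Suc n)
  then obtain i where i: "i \<in> simple_ix W" "W.len w = Suc (W.len (w \<otimes>\<^bsub>W\<^esub> W.s i))"
    using W.last_letter[of w] W.len_one by (metis nat.distinct(1))
  define v where "v = w \<otimes>\<^bsub>W\<^esub> W.s i"
  have v: "v \<in> carrier W" "w = v \<otimes>\<^bsub>W\<^esub> W.s i" using i Suc.prems by (auto simp: v_def)
  have len_v: "W.len w = Suc (W.len v)" using i(2) by (simp add: v_def)
  then have IH: "V.len (h v) = W.len v" using Suc.hyps v(1) by (metis Suc_inject)
  have "nonneg (W.act v (basis_vec i))"
    using W.act_basis_pos_iff(1)[OF v(1) i(1)] len_v v(2) by (metis lessI)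
  then have "nonneg (V.act (h v) (basis_vec (f i)))"
    using pushed_nonneg pushed_act v i by blast
  then have "V.len (h v) < V.len (h w)"
    using V.act_basis_pos_iff(1)[of "h v" "f i"] v(1) i(1)
    by (simp add: v(2) h_mult[OF v(1) W.s_closed] h_s)
  moreover have "V.len (h w) \<le> Suc (V.len (h v))"
    using V.len_mult_s(1)[of "h v" "f i"] v(1) i(1)
    by (simp add: v(2) h_mult[OF v(1) W.s_closed] h_s)
  ultimately show ?case using IH len_v by linarith
qed

lemma h_inj: "v \<in> carrier W \<Longrightarrow> w \<in> carrier W \<Longrightarrow> h v = h w \<Longrightarrow> v = w"
proof -
  assume *: "v \<in> carrier W" "w \<in> carrier W" "h v = h w"
  then have "h (inv\<^bsub>W\<^esub> v \<otimes>\<^bsub>W\<^esub> w) = \<one>\<^bsub>V\<^esub>" by (simp add: h_mult h_inv)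
  then have "inv\<^bsub>W\<^esub> v \<otimes>\<^bsub>W\<^esub> w = \<one>\<^bsub>W\<^esub>"
    using h_len[of "inv\<^bsub>W\<^esub> v \<otimes>\<^bsub>W\<^esub> w"] * W.len_eq_0[of "inv\<^bsub>W\<^esub> v \<otimes>\<^bsub>W\<^esub> w"] by simp
  then show "v = w" using * by (metis W.inv_cancel(2) W.r_one)
qed

lemma h_refls: "t \<in> W.refls \<Longrightarrow> h t \<in> V.refls"
  by (erule W.rfl_cases) (simp add: h_mult h_s h_inv V.rfl_in_refls)

lemma refl_in_image:
  assumes "t \<in> V.refls" "t \<in> parabolic V (f ` simple_ix W)"
  obtains r where "r \<in> W.refls" "t = h r"
proof -
  obtain u j where u: "u \<in> parabolic V (f ` simple_ix W)" "j \<in> f ` simple_ix W" "t = V.rfl u j"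
    using V.refl_in_parabolic[OF f_ix assms] by blast
  then obtain w i where "w \<in> carrier W" "u = h w" "i \<in> simple_ix W" "j = f i"
    using h_image by blast
  then have "t = h (W.rfl w i)" "W.rfl w i \<in> W.refls"
    using u(3) W.rfl_in_refls by (simp_all add: h_mult h_s h_inv)
  then show ?thesis using that by blast
qed

end

section \<open>The glued group\<close>

locale glued_coxeter = W: coxeter_system W + V: coxeter_system V
  for W :: "('g, 'i, 'y) coxeter_scheme" and V :: "('h, 'i + 'i, 'z) coxeter_scheme" +
  fixes K :: "'i set"
  assumes K: "K \<subseteq> simple_ix W"
    and glued: "glued_system W K V"
begin

sublocale flat: coxeter_embedding W V flat_ix
  using glued by unfold_locales (auto simp: glued_system_def Let_def flat_ix_def inj_on_def)

sublocale sharp: coxeter_embedding W V "sharp_ix K"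
  using glued
  by unfold_locales (auto simp: glued_system_def Let_def sharp_ix_def inj_on_def split: if_splits)

abbreviation "flat_part \<equiv> flat_ix ` simple_ix W"
abbreviation "sharp_part \<equiv> sharp_ix K ` simple_ix W"
abbreviation "fl \<equiv> flat_map W V"
abbreviation "sh \<equiv> sharp_map W K V"
abbreviation "nu \<equiv> nu_map W K V"
abbreviation "tle \<equiv> twisted_le V flat_part"

lemmas flat_part_ix = flat.f_ix
lemmas sharp_part_ix = sharp.f_ix

lemmas fl_closed [simp] = flat.h_closed[folded flat_map_def]
lemmas fl_mult = flat.h_mult[folded flat_map_def]
lemmas fl_len = flat.h_len[folded flat_map_def]
lemmas fl_inj = flat.h_inj[folded flat_map_def]
lemmas fl_refls = flat.h_refls[folded flat_map_def]
lemmas fl_image = flat.h_image[folded flat_map_def]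
lemmas fl_parabolic = flat.h_in_parabolic_ix[folded flat_map_def]
lemmas fl_refl_in_image = flat.refl_in_image[folded flat_map_def]

lemmas sh_closed [simp] = sharp.h_closed[folded sharp_map_def]
lemmas sh_mult = sharp.h_mult[folded sharp_map_def]
lemmas sh_s = sharp.h_s[folded sharp_map_def]
lemmas sh_inv = sharp.h_inv[folded sharp_map_def]
lemmas sh_len = sharp.h_len[folded sharp_map_def]
lemmas sh_inj = sharp.h_inj[folded sharp_map_def]
lemmas sh_refls = sharp.h_refls[folded sharp_map_def]
lemmas sh_image = sharp.h_image[folded sharp_map_def]
lemmas sh_parabolic = sharp.h_in_parabolic_ix[folded sharp_map_def]
lemmas sh_refl_in_image = sharp.refl_in_image[folded sharp_map_def]

section \<open>Normal form of products of flat and sharp elements\<close>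

lemma sh_eq_fl:
  assumes "u \<in> parabolic W K"
  shows "sh u = fl u"
proof -
  obtain xs where xs: "xs \<in> lists K" "W.val xs = u"
    using W.parabolic_reduced_word[OF K assms] by blast
  then have ix: "xs \<in> lists (simple_ix W)" using K by auto
  have eq: "map (sharp_ix K) xs = map flat_ix xs"
    using xs(1) by (induction xs) (auto simp: sharp_ix_def flat_ix_def)
  then show ?thesis
    using sharp.h_val[OF ix] flat.h_val[OF ix] unfolding flat_map_def sharp_map_def xs(2) eq by simp
qed

lemma min_reps_closed: "w \<in> min_reps W K \<Longrightarrow> w \<in> carrier W"
  by (simp add: min_reps_def)

lemma nu_eq: "nu (v, w) = fl v \<otimes>\<^bsub>V\<^esub> sh (inv\<^bsub>W\<^esub> w)"
  by (simp add: nu_map_def)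

text \<open>A flat letter that shortens a sharp element must itself belong to the sharp subgroup, so
  its index comes from \<open>K\<close>. There minimality of \<open>w\<close> excludes it.\<close>

lemma sh_left_min:
  assumes w: "w \<in> min_reps W K"
  shows "sh (inv\<^bsub>W\<^esub> w) \<in> V.left_min flat_part"
proof (rule V.left_minI[OF flat_part_ix])
  have wc: "w \<in> carrier W" using w min_reps_closed by blast
  define b where "b = inv\<^bsub>W\<^esub> w"
  have b: "b \<in> carrier W" "b \<in> W.left_min K"
    using w wc W.inv_in_left_min[OF K] by (auto simp: b_def)
  show "sh (inv\<^bsub>W\<^esub> w) \<in> carrier V" using wc by simp
  fix j assume j: "j \<in> flat_part"
  show "\<not> V.len (V.s j \<otimes>\<^bsub>V\<^esub> sh (inv\<^bsub>W\<^esub> w)) < V.len (sh (inv\<^bsub>W\<^esub> w))"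
  proof
    assume less: "V.len (V.s j \<otimes>\<^bsub>V\<^esub> sh (inv\<^bsub>W\<^esub> w)) < V.len (sh (inv\<^bsub>W\<^esub> w))"
    have jix: "j \<in> simple_ix V" using j flat_part_ix by blast
    have "V.s j \<in> parabolic V sharp_part"
      using less unfolding b_def[symmetric]
      by (rule V.refl_descent_parabolic[OF sharp_part_ix sh_parabolic[OF b(1)] V.s_in_refls[OF jix]])
    then have "j \<in> sharp_part" using V.s_in_parabolic[OF sharp_part_ix jix] by blast
    then obtain k where k: "k \<in> K" "j = sharp_ix K k"
      using j by (auto simp: flat_ix_def sharp_ix_def split: if_splits)
    then have kix: "k \<in> simple_ix W" using K by blast
    then have "V.len (V.s j \<otimes>\<^bsub>V\<^esub> sh b) = W.len (W.s k \<otimes>\<^bsub>W\<^esub> b)"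
      using k b(1) sh_len[of "W.s k \<otimes>\<^bsub>W\<^esub> b"] by (simp add: sh_mult sh_s)
    moreover have "W.len b \<le> W.len (W.s k \<otimes>\<^bsub>W\<^esub> b)"
      using b(2) W.parabolic_s[OF k(1)] by (simp add: W.left_min_def)
    ultimately show False using less sh_len[OF b(1)] by (simp add: b_def)
  qed
qed

lemma nu_closed: "v \<in> carrier W \<Longrightarrow> w \<in> carrier W \<Longrightarrow> nu (v, w) \<in> carrier V"
  by (simp add: nu_eq)

lemma nu_inj:
  assumes "v \<in> carrier W" "w \<in> min_reps W K" "v' \<in> carrier W" "w' \<in> min_reps W K"
    and "nu (v, w) = nu (v', w')"
  shows "v = v' \<and> w = w'"
proof -
  have c: "w \<in> carrier W" "w' \<in> carrier W" using assms min_reps_closed by auto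
  have "fl v = fl v' \<and> sh (inv\<^bsub>W\<^esub> w) = sh (inv\<^bsub>W\<^esub> w')"
    using assms sh_left_min fl_parabolic
    by (intro V.left_min_unique[OF flat_part_ix]) (auto simp: nu_eq)
  then have "v = v'" "inv\<^bsub>W\<^esub> w = inv\<^bsub>W\<^esub> w'"
    using fl_inj[OF assms(1,3)] sh_inj[OF W.inv_closed[OF c(1)] W.inv_closed[OF c(2)]] by auto
  then show ?thesis using W.inv_inv[OF c(1)] W.inv_inv[OF c(2)] by metis
qed

text \<open>Split off from \<open>b\<close> its factor in the subgroup of \<open>K\<close>. The two
  embeddings agree on this factor, so it can be moved into the flat part.\<close>

lemma fl_sh_decomp:
  assumes v: "v \<in> carrier W" and b: "b \<in> carrier W"
  obtains u w where "u \<in> parabolic W K" "w \<in> min_reps W K" "b = u \<otimes>\<^bsub>W\<^esub> inv\<^bsub>W\<^esub> w"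
    "W.len w \<le> W.len b" "fl v \<otimes>\<^bsub>V\<^esub> sh b = nu (v \<otimes>\<^bsub>W\<^esub> u, w)"
proof -
  obtain u c where uc: "u \<in> parabolic W K" "c \<in> W.left_min K" "b = u \<otimes>\<^bsub>W\<^esub> c"
    using W.left_min_decomp[OF K b] by blast
  have cc: "c \<in> carrier W" using uc W.left_min_closed by blast
  have u: "u \<in> carrier W" using uc W.parabolic_closed[OF K] by blast
  define w where "w = inv\<^bsub>W\<^esub> c"
  have w: "w \<in> carrier W" "c = inv\<^bsub>W\<^esub> w" using cc by (auto simp: w_def)
  have "w \<in> min_reps W K" using W.inv_in_left_min[OF K w(1)] uc w by simp
  moreover have "W.len w \<le> W.len b"
    using W.len_left_min[OF K uc(2,1)] uc(3) w cc by simp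
  moreover have "fl v \<otimes>\<^bsub>V\<^esub> sh b = nu (v \<otimes>\<^bsub>W\<^esub> u, w)"
    using v u cc w(2) uc(3)
    by (simp add: nu_eq sh_mult fl_mult sh_eq_fl[OF uc(1)] V.m_assoc)
  ultimately show ?thesis using that uc w by blast
qed

lemma double_product:
  "parabolic V flat_part <#>\<^bsub>V\<^esub> parabolic V sharp_part = nu ` (carrier W \<times> min_reps W K)"
proof (intro equalityI subsetI)
  fix x assume "x \<in> parabolic V flat_part <#>\<^bsub>V\<^esub> parabolic V sharp_part"
  then obtain v b where vb: "v \<in> carrier W" "b \<in> carrier W" "x = fl v \<otimes>\<^bsub>V\<^esub> sh b"
    unfolding set_mult_def fl_image[symmetric] sh_image[symmetric] by blast
  then obtain u w where "u \<in> parabolic W K" "w \<in> min_reps W K" "x = nu (v \<otimes>\<^bsub>W\<^esub> u, w)"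
    using fl_sh_decomp[OF vb(1,2)] by metis
  then show "x \<in> nu ` (carrier W \<times> min_reps W K)"
    using vb W.parabolic_closed[OF K] by blast
next
  fix x assume "x \<in> nu ` (carrier W \<times> min_reps W K)"
  then obtain v w where vw: "v \<in> carrier W" "w \<in> min_reps W K" "x = nu (v, w)" by blast
  then show "x \<in> parabolic V flat_part <#>\<^bsub>V\<^esub> parabolic V sharp_part"
    unfolding set_mult_def nu_eq
    using fl_parabolic[OF vw(1)] sh_parabolic[OF W.inv_closed[OF min_reps_closed[OF vw(2)]]] by blast
qed

section \<open>Descending from a value of \<open>nu\<close>\<close>

text \<open>A reflection in the flat subgroup acts on \<open>v\<close> alone and raises it. For any
  other one, the conjugate by \<open>fl v\<close> shortens the sharp factor, and the result is
  brought back to normal form by moving a factor \<open>u\<close> to the left.\<close>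

lemma step_below_nu:
  assumes v: "v \<in> carrier W" and w: "w \<in> min_reps W K"
    and step: "V.twisted_step flat_part y (nu (v, w))"
  obtains (raise) v' where "v' \<in> carrier W" "bruhat_le W v v'" "y = nu (v', w)"
  | (lower) u w' where "u \<in> parabolic W K" "w' \<in> min_reps W K"
      "bruhat_le W (w' \<otimes>\<^bsub>W\<^esub> inv\<^bsub>W\<^esub> u) w" "y = nu (v \<otimes>\<^bsub>W\<^esub> u, w')"
proof -
  have wc: "w \<in> carrier W" using w min_reps_closed by blast
  define b where "b = inv\<^bsub>W\<^esub> w"
  have b: "b \<in> carrier W" using wc by (simp add: b_def)
  have bmin: "sh b \<in> V.left_min flat_part" using sh_left_min[OF w] by (simp add: b_def)
  have x: "nu (v, w) = fl v \<otimes>\<^bsub>V\<^esub> sh b" by (simp add: nu_eq b_def)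
  have flv: "fl v \<in> parabolic V flat_part" using fl_parabolic v by blast
  obtain t where t: "t \<in> V.refls" "y = t \<otimes>\<^bsub>V\<^esub> nu (v, w)"
    "if t \<in> parabolic V flat_part then V.len (nu (v, w)) < V.len (t \<otimes>\<^bsub>V\<^esub> nu (v, w))
     else V.len (t \<otimes>\<^bsub>V\<^esub> nu (v, w)) < V.len (nu (v, w))"
    using step by (auto simp: V.twisted_step_def)
  show ?thesis
  proof (cases "t \<in> parabolic V flat_part")
    case True
    obtain r where r: "r \<in> W.refls" "t = fl r"
      using fl_refl_in_image[OF t(1) True] by blast
    have rc: "r \<in> carrier W" using r W.refls_closed by blast
    have "V.len (fl v) < V.len (t \<otimes>\<^bsub>V\<^esub> fl v)"
      using t(3) True V.len_refl_decomp_in[OF flat_part_ix flv bmin True] by (simp add: x)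
    then have "W.len v < W.len (r \<otimes>\<^bsub>W\<^esub> v)"
      using fl_len[OF v] fl_len[of "r \<otimes>\<^bsub>W\<^esub> v"] rc v r(2) by (simp add: fl_mult)
    then have "bruhat_le W v (r \<otimes>\<^bsub>W\<^esub> v)" using W.bruhat_le_refl_mult r v by blast
    moreover have "y = nu (r \<otimes>\<^bsub>W\<^esub> v, w)"
      using t(2) r(2) rc v wc by (simp add: nu_eq fl_mult V.m_assoc)
    ultimately show ?thesis by (rule raise[OF W.m_closed[OF rc v]])
  next
    case False
    define t' where "t' = inv\<^bsub>V\<^esub> fl v \<otimes>\<^bsub>V\<^esub> t \<otimes>\<^bsub>V\<^esub> fl v"
    have t': "t' \<in> V.refls" unfolding t'_def using t(1) v by (intro V.refls_conj') auto
    have less: "V.len (t' \<otimes>\<^bsub>V\<^esub> sh b) < V.len (sh b)"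
      using t(3) False V.len_refl_decomp_notin[OF flat_part_ix flv bmin t(1) False]
      by (simp add: x t'_def)
    \<comment> \<open>A reflection that shortens a sharp element is sharp. Hence the step does not
      leave the product of the two subgroups.\<close>
    then have "t' \<in> parabolic V sharp_part"
      using V.refl_descent_parabolic[OF sharp_part_ix sh_parabolic[OF b] t'] by blast
    then obtain r where r: "r \<in> W.refls" "t' = sh r"
      using sh_refl_in_image[OF t'] by blast
    have rc: "r \<in> carrier W" using r W.refls_closed by blast
    have rb: "W.len (r \<otimes>\<^bsub>W\<^esub> b) < W.len b"
      using less sh_len[OF b] sh_len[of "r \<otimes>\<^bsub>W\<^esub> b"] rc b r(2) by (simp add: sh_mult)
    obtain u w' where u: "u \<in> parabolic W K" "w' \<in> min_reps W K" "r \<otimes>\<^bsub>W\<^esub> b = u \<otimes>\<^bsub>W\<^esub> inv\<^bsub>W\<^esub> w'"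
      "fl v \<otimes>\<^bsub>V\<^esub> sh (r \<otimes>\<^bsub>W\<^esub> b) = nu (v \<otimes>\<^bsub>W\<^esub> u, w')"
      using fl_sh_decomp[OF v, of "r \<otimes>\<^bsub>W\<^esub> b"] rc b by (metis W.m_closed)
    have c: "u \<in> carrier W" "w' \<in> carrier W" using u W.parabolic_closed[OF K] min_reps_closed by auto
    have "t \<otimes>\<^bsub>V\<^esub> fl v = fl v \<otimes>\<^bsub>V\<^esub> t'"
      using V.refls_closed[OF t(1)] v by (simp add: t'_def V.m_assoc)
    then have "y = fl v \<otimes>\<^bsub>V\<^esub> sh (r \<otimes>\<^bsub>W\<^esub> b)"
      using t(2) x r(2) rc b v V.refls_closed[OF t(1)]
      by (simp add: sh_mult V.m_assoc[symmetric])
    then have y: "y = nu (v \<otimes>\<^bsub>W\<^esub> u, w')" using u(4) by simp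
    \<comment> \<open>Inverting \<open>r b < b\<close> gives the comparison of
      \<open>w' u^-1\<close> with \<open>w\<close>.\<close>
    have "bruhat_le W (r \<otimes>\<^bsub>W\<^esub> b) (r \<otimes>\<^bsub>W\<^esub> (r \<otimes>\<^bsub>W\<^esub> b))"
      using r(1) rc b rb by (intro W.bruhat_le_refl_mult) auto
    then have "bruhat_le W (inv\<^bsub>W\<^esub> (r \<otimes>\<^bsub>W\<^esub> b)) (inv\<^bsub>W\<^esub> b)"
      using W.bruhat_inv r(1) b by fastforce
    moreover have "inv\<^bsub>W\<^esub> (r \<otimes>\<^bsub>W\<^esub> b) = w' \<otimes>\<^bsub>W\<^esub> inv\<^bsub>W\<^esub> u"
      unfolding u(3) using c by (simp add: W.inv_mult_group)
    ultimately have "bruhat_le W (w' \<otimes>\<^bsub>W\<^esub> inv\<^bsub>W\<^esub> u) w" using wc by (simp add: b_def)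
    then show ?thesis using lower u(1,2) y by blast
  qed
qed

text \<open>Follow the chain downwards from \<open>nu (v, w)\<close> and update \<open>u\<close> at
  each step. A raising step takes the new \<open>u'\<close> from
  \<open>bruhat_mult_parabolic\<close>; a lowering step cancels the factor that was moved to the
  flat side.\<close>

lemma below_nu:
  assumes v: "v \<in> carrier W" and w: "w \<in> min_reps W K" and le: "tle y (nu (v, w))"
  obtains v' w' u where "v' \<in> carrier W" "w' \<in> min_reps W K" "y = nu (v', w')"
    "u \<in> parabolic W K" "bruhat_le W v (v' \<otimes>\<^bsub>W\<^esub> u)" "bruhat_le W (w' \<otimes>\<^bsub>W\<^esub> u) w"
proof -
  have "(V.twisted_step flat_part)\<^sup>*\<^sup>* y (nu (v, w))"
    using le V.twisted_le_iff[OF flat_part_ix] by blast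
  then have "\<exists>v'\<in>carrier W. \<exists>w'\<in>min_reps W K. \<exists>u\<in>parabolic W K. y = nu (v', w') \<and>
      bruhat_le W v (v' \<otimes>\<^bsub>W\<^esub> u) \<and> bruhat_le W (w' \<otimes>\<^bsub>W\<^esub> u) w"
  proof (induction rule: converse_rtranclp_induct)
    case base
    have "bruhat_le W v v" "bruhat_le W w w" "w \<in> carrier W"
      using v w min_reps_closed W.bruhat_refl by auto
    then have "nu (v, w) = nu (v, w) \<and>
        bruhat_le W v (v \<otimes>\<^bsub>W\<^esub> \<one>\<^bsub>W\<^esub>) \<and> bruhat_le W (w \<otimes>\<^bsub>W\<^esub> \<one>\<^bsub>W\<^esub>) w"
      using v by simp
    then show ?case using v w W.parabolic_one[OF K] by blast
  next
    case (step z y)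
    then obtain v' w' u where IH: "v' \<in> carrier W" "w' \<in> min_reps W K" "u \<in> parabolic W K"
      "y = nu (v', w')" "bruhat_le W v (v' \<otimes>\<^bsub>W\<^esub> u)" "bruhat_le W (w' \<otimes>\<^bsub>W\<^esub> u) w"
      by blast
    have uc: "u \<in> carrier W" using IH W.parabolic_closed[OF K] by blast
    from IH(1,2) step(1)[unfolded IH(4)] show ?case
    proof (cases rule: step_below_nu)
      case (raise v'')
      obtain u' where u': "u' \<in> parabolic W K"
        "bruhat_le W (v' \<otimes>\<^bsub>W\<^esub> u) (v'' \<otimes>\<^bsub>W\<^esub> u')" "bruhat_le W (w' \<otimes>\<^bsub>W\<^esub> u') (w' \<otimes>\<^bsub>W\<^esub> u)"
        using W.bruhat_mult_parabolic[OF K IH(2) raise(2) IH(3)] by blast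
      have "bruhat_le W v (v'' \<otimes>\<^bsub>W\<^esub> u')" "bruhat_le W (w' \<otimes>\<^bsub>W\<^esub> u') w"
        using W.bruhat_trans[OF IH(5) u'(2)] W.bruhat_trans[OF u'(3) IH(6)] by auto
      then show ?thesis using raise IH(2) u'(1) by blast
    next
      case (lower x w'')
      \<comment> \<open>With this choice \<open>v' x u' = v' u\<close>, so the inequality above
        \<open>v\<close> is inherited.\<close>
      define u' where "u' = inv\<^bsub>W\<^esub> x \<otimes>\<^bsub>W\<^esub> u"
      have c: "x \<in> carrier W" "w'' \<in> carrier W"
        using lower W.parabolic_closed[OF K] min_reps_closed by auto
      have u': "u' \<in> parabolic W K"
        unfolding u'_def using lower(1) IH(3) by (intro W.parabolic_mult[OF K] W.parabolic_inv[OF K])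
      have "bruhat_le W (w'' \<otimes>\<^bsub>W\<^esub> inv\<^bsub>W\<^esub> x \<otimes>\<^bsub>W\<^esub> u) (w' \<otimes>\<^bsub>W\<^esub> u)"
        using W.bruhat_mult_min_reps[OF K IH(2) lower(3) IH(3)] .
      then have "bruhat_le W (w'' \<otimes>\<^bsub>W\<^esub> u') w"
        using W.bruhat_trans[OF _ IH(6)] c uc by (simp add: u'_def W.m_assoc)
      moreover have "bruhat_le W v (v' \<otimes>\<^bsub>W\<^esub> x \<otimes>\<^bsub>W\<^esub> u')"
        using IH(1,5) c uc by (simp add: u'_def W.m_assoc)
      moreover have "v' \<otimes>\<^bsub>W\<^esub> x \<in> carrier W" using IH(1) c by simp
      ultimately show ?thesis using lower u' by blast
    qed
  qed
  then show ?thesis using that by blast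
qed

section \<open>Constructing elements below a value of \<open>nu\<close>\<close>

text \<open>Each Bruhat step acts as a flat reflection on the first factor, and for flat reflections
  the twisted order reverses length.\<close>

lemma nu_raise:
  assumes "bruhat_le W v v'" and w: "w \<in> min_reps W K"
  shows "tle (nu (v', w)) (nu (v, w))"
proof -
  have wc: "w \<in> carrier W" using w min_reps_closed by blast
  have step: "V.twisted_step flat_part (nu (z, w)) (nu (y, w))" if yz: "W.bruhat_step y z" for y z
  proof -
    obtain t where t: "t \<in> W.refls" "z = t \<otimes>\<^bsub>W\<^esub> y" "y \<in> carrier W" "W.len y < W.len (t \<otimes>\<^bsub>W\<^esub> y)"
      using yz by (auto simp: W.bruhat_step_def)
    have tc: "t \<in> carrier W" using t W.refls_closed by blast
    have par: "fl t \<in> parabolic V flat_part" "fl y \<in> parabolic V flat_part"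
      using fl_parabolic tc t(3) by auto
    have "V.len (fl y) < V.len (fl t \<otimes>\<^bsub>V\<^esub> fl y)"
      using t tc fl_len[of y] fl_len[of "t \<otimes>\<^bsub>W\<^esub> y"] by (simp add: fl_mult)
    then have "V.len (nu (y, w)) < V.len (fl t \<otimes>\<^bsub>V\<^esub> nu (y, w))"
      using V.len_refl_decomp_in[OF flat_part_ix par(2) sh_left_min[OF w] par(1)] by (simp add: nu_eq)
    moreover have "nu (z, w) = fl t \<otimes>\<^bsub>V\<^esub> nu (y, w)"
      using t tc wc by (simp add: nu_eq fl_mult V.m_assoc)
    ultimately show ?thesis
      unfolding V.twisted_step_def using par fl_refls[OF t(1)] nu_closed[OF t(3) wc] by auto
  qed
  have "W.bruhat_step\<^sup>*\<^sup>* v v'" and vc: "v \<in> carrier W" "v' \<in> carrier W"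
    using assms by (auto simp: W.bruhat_le_iff)
  then have "(V.twisted_step flat_part)\<^sup>*\<^sup>* (nu (v', w)) (nu (v, w))"
    by (induction rule: rtranclp_induct) (auto intro: step converse_rtranclp_into_rtranclp dest: W.bruhat_step_closed)
  then show ?thesis
    using V.twisted_le_iff[OF flat_part_ix] nu_closed vc wc by auto
qed

text \<open>The left reflection is the conjugate of \<open>sh r\<close> by \<open>fl v\<close>. It
  is not flat, because a flat reflection cannot shorten the minimal element
  \<open>sh (inv w)\<close>.\<close>

lemma twisted_step_sharp:
  assumes v: "v \<in> carrier W" and w: "w \<in> min_reps W K" and r: "r \<in> W.refls"
    and less: "W.len (r \<otimes>\<^bsub>W\<^esub> inv\<^bsub>W\<^esub> w) < W.len w"
  shows "V.twisted_step flat_part (fl v \<otimes>\<^bsub>V\<^esub> sh (r \<otimes>\<^bsub>W\<^esub> inv\<^bsub>W\<^esub> w)) (nu (v, w))"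
proof -
  have wc: "w \<in> carrier W" using w min_reps_closed by blast
  have rc: "r \<in> carrier W" using r W.refls_closed by blast
  have flv: "fl v \<in> parabolic V flat_part" using fl_parabolic v by blast
  define b where "b = inv\<^bsub>W\<^esub> w"
  have b: "b \<in> carrier W" "W.len b = W.len w" using wc by (auto simp: b_def)
  have bmin: "sh b \<in> V.left_min flat_part" using sh_left_min[OF w] by (simp add: b_def)
  have less': "V.len (sh r \<otimes>\<^bsub>V\<^esub> sh b) < V.len (sh b)"
    using less b rc sh_len[of b] sh_len[of "r \<otimes>\<^bsub>W\<^esub> b"] by (simp add: b_def[symmetric] sh_mult)
  define t where "t = fl v \<otimes>\<^bsub>V\<^esub> sh r \<otimes>\<^bsub>V\<^esub> inv\<^bsub>V\<^esub> fl v"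
  have t: "t \<in> V.refls" unfolding t_def using sh_refls[OF r] v by (intro V.refls_conj) auto
  have conj: "inv\<^bsub>V\<^esub> fl v \<otimes>\<^bsub>V\<^esub> t \<otimes>\<^bsub>V\<^esub> fl v = sh r"
    using v rc by (simp add: t_def V.m_assoc)
  have notin: "t \<notin> parabolic V flat_part"
    using V.refl_descent_left_min[OF flat_part_ix bmin less']
      V.conj_parabolic_iff[OF flat_part_ix flv V.refls_closed[OF t]] conj by simp
  have "V.len (t \<otimes>\<^bsub>V\<^esub> (fl v \<otimes>\<^bsub>V\<^esub> sh b)) < V.len (fl v \<otimes>\<^bsub>V\<^esub> sh b)"
    using V.len_refl_decomp_notin[OF flat_part_ix flv bmin t notin] conj less' by simp
  moreover have "t \<otimes>\<^bsub>V\<^esub> (fl v \<otimes>\<^bsub>V\<^esub> sh b) = fl v \<otimes>\<^bsub>V\<^esub> sh (r \<otimes>\<^bsub>W\<^esub> b)"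
    using v rc b by (simp add: t_def V.m_assoc sh_mult)
  ultimately show ?thesis
    unfolding V.twisted_step_def nu_eq b_def[symmetric] using t notin v b by auto
qed

text \<open>Remove the first letter \<open>i\<close> of a reduced word of \<open>w\<close>. Lifting
  in the Bruhat order reduces the claim to the shorter \<open>w1\<close>, and lifting in the twisted
  order multiplies the sharp letter back on the right.\<close>

lemma nu_lower:
  assumes v: "v \<in> carrier W"
  shows "w \<in> min_reps W K \<Longrightarrow> bruhat_le W y w \<Longrightarrow> tle (fl v \<otimes>\<^bsub>V\<^esub> sh (inv\<^bsub>W\<^esub> y)) (nu (v, w))"
proof (induction "W.len w" arbitrary: w y)
  case 0
  then have "y = w" using W.bruhat_le_len by fastforce
  then show ?case
    using V.twisted_refl[OF flat_part_ix] nu_closed v min_reps_closed[OF "0.prems"(1)] by (simp add: nu_eq)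
next
  case (Suc n)
  note w = Suc.prems(1) and le = Suc.prems(2)
  have c: "w \<in> carrier W" "y \<in> carrier W" using w le min_reps_closed by (auto simp: W.bruhat_le_iff)
  have "inv\<^bsub>W\<^esub> w \<noteq> \<one>\<^bsub>W\<^esub>"
    using Suc.hyps(2) c W.len_inv[OF c(1)] by auto
  then obtain i where i: "i \<in> simple_ix W" "W.len (inv\<^bsub>W\<^esub> w) = Suc (W.len (inv\<^bsub>W\<^esub> w \<otimes>\<^bsub>W\<^esub> W.s i))"
    using W.last_letter[OF W.inv_closed[OF c(1)]] by blast
  define w1 where "w1 = W.s i \<otimes>\<^bsub>W\<^esub> w"
  define y1 where "y1 = W.s i \<otimes>\<^bsub>W\<^esub> y"
  have c1: "w1 \<in> carrier W" "y1 \<in> carrier W" using c i by (auto simp: w1_def y1_def)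
  have inv1: "inv\<^bsub>W\<^esub> w1 = inv\<^bsub>W\<^esub> w \<otimes>\<^bsub>W\<^esub> W.s i" "inv\<^bsub>W\<^esub> y1 = inv\<^bsub>W\<^esub> y \<otimes>\<^bsub>W\<^esub> W.s i"
    using c i by (auto simp: w1_def y1_def W.inv_mult_group)
  have len1: "W.len w = Suc (W.len w1)"
    using i(2) W.len_inv[OF c(1)] W.len_inv[OF c1(1)] by (simp add: inv1)
  \<comment> \<open>\<open>s i\<close> shortens \<open>w\<close> by exactly one, and shortens every
    other element of its coset by at most one.\<close>
  have w1: "w1 \<in> min_reps W K"
  proof -
    have "W.len w1 \<le> W.len (w1 \<otimes>\<^bsub>W\<^esub> u)" if u: "u \<in> parabolic W K" for u
    proof -
      have uc: "u \<in> carrier W" using u W.parabolic_closed[OF K] by blast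
      have "W.len w \<le> W.len (w \<otimes>\<^bsub>W\<^esub> u)" using w u by (simp add: min_reps_def)
      also have "w \<otimes>\<^bsub>W\<^esub> u = W.s i \<otimes>\<^bsub>W\<^esub> (w1 \<otimes>\<^bsub>W\<^esub> u)" using c uc i by (simp add: w1_def W.m_assoc)
      also have "W.len \<dots> \<le> Suc (W.len (w1 \<otimes>\<^bsub>W\<^esub> u))"
        using W.len_mult[of "W.s i" "w1 \<otimes>\<^bsub>W\<^esub> u"] W.len_s_le[OF i(1)] c1 uc i by simp
      finally show ?thesis using len1 by simp
    qed
    then show ?thesis using c1 by (simp add: min_reps_def)
  qed
  have fi: "sharp_ix K i \<in> simple_ix V" using sharp.f_closed i by blast
  have up: "tle (nu (v, w1)) (nu (v, w))"
  proof -
    \<comment> \<open>This rewrites multiplication of \<open>inv w\<close> by \<open>s i\<close> on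
      the right as a reflection on the left.\<close>
    define r where "r = inv\<^bsub>W\<^esub> w \<otimes>\<^bsub>W\<^esub> W.s i \<otimes>\<^bsub>W\<^esub> w"
    have r: "r \<in> W.refls" unfolding r_def using i c by (intro W.refls_conj') auto
    have "r \<otimes>\<^bsub>W\<^esub> inv\<^bsub>W\<^esub> w = inv\<^bsub>W\<^esub> w1" using c i by (simp add: r_def inv1 W.m_assoc)
    then have "V.twisted_step flat_part (nu (v, w1)) (nu (v, w))"
      using twisted_step_sharp[OF v w r] len1 c1 by (simp add: nu_eq)
    then show ?thesis
      using V.twisted_le_iff[OF flat_part_ix] V.twisted_step_closed by (metis r_into_rtranclp)
  qed
  from W.bruhat_lift_down[OF W.bruhat_inv[OF le] i(1)] show ?case
  proof
    assume "bruhat_le W (inv\<^bsub>W\<^esub> y) (inv\<^bsub>W\<^esub> w \<otimes>\<^bsub>W\<^esub> W.s i)"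
    then have "bruhat_le W y w1"
      using W.bruhat_inv c c1 inv1 by (metis W.inv_inv)
    then have "tle (fl v \<otimes>\<^bsub>V\<^esub> sh (inv\<^bsub>W\<^esub> y)) (nu (v, w1))"
      using Suc.hyps w1 len1 by simp
    then show ?thesis using V.twisted_trans[OF flat_part_ix _ up] by blast
  next
    assume "bruhat_le W (inv\<^bsub>W\<^esub> y \<otimes>\<^bsub>W\<^esub> W.s i) (inv\<^bsub>W\<^esub> w \<otimes>\<^bsub>W\<^esub> W.s i)"
    then have "bruhat_le W y1 w1"
      using W.bruhat_inv c1 inv1 by (metis W.inv_inv)
    then have "tle (fl v \<otimes>\<^bsub>V\<^esub> sh (inv\<^bsub>W\<^esub> y1)) (nu (v, w1))"
      using Suc.hyps w1 len1 by simp
    moreover have "fl v \<otimes>\<^bsub>V\<^esub> sh (inv\<^bsub>W\<^esub> z1) \<otimes>\<^bsub>V\<^esub> V.s (sharp_ix K i) = fl v \<otimes>\<^bsub>V\<^esub> sh (inv\<^bsub>W\<^esub> z)"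
      if "z \<in> carrier W" "inv\<^bsub>W\<^esub> z1 = inv\<^bsub>W\<^esub> z \<otimes>\<^bsub>W\<^esub> W.s i" for z z1
      using that v i fi by (simp add: sh_mult sh_s V.m_assoc)
    then have eq: "fl v \<otimes>\<^bsub>V\<^esub> sh (inv\<^bsub>W\<^esub> y1) \<otimes>\<^bsub>V\<^esub> V.s (sharp_ix K i) = fl v \<otimes>\<^bsub>V\<^esub> sh (inv\<^bsub>W\<^esub> y)"
      "nu (v, w1) \<otimes>\<^bsub>V\<^esub> V.s (sharp_ix K i) = nu (v, w)"
      using c inv1 by (auto simp: nu_eq)
    \<comment> \<open>The second alternative of lifting ends at \<open>nu (v, w1)\<close>, which by
      \<open>up\<close> lies below the target.\<close>
    ultimately have "tle (fl v \<otimes>\<^bsub>V\<^esub> sh (inv\<^bsub>W\<^esub> y)) (nu (v, w)) \<or>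
        tle (fl v \<otimes>\<^bsub>V\<^esub> sh (inv\<^bsub>W\<^esub> y)) (nu (v, w1))"
      using V.twisted_lift_up[OF flat_part_ix _ fi] by metis
    then show ?thesis using V.twisted_trans[OF flat_part_ix _ up] by blast
  qed
qed

text \<open>For the converse, \<open>(v' u, w' u)\<close> has the same product as
  \<open>(v', w')\<close>, since \<open>u\<close> cancels between the two factors. One passes from
  there first to \<open>nu (v' u, w)\<close> and then to \<open>nu (v, w)\<close>.\<close>

theorem twisted_nu_iff:
  assumes "v \<in> carrier W" "w \<in> min_reps W K" "v' \<in> carrier W" "w' \<in> min_reps W K"
  shows "tle (nu (v', w')) (nu (v, w)) \<longleftrightarrow>
    (\<exists>u\<in>parabolic W K. bruhat_le W v (v' \<otimes>\<^bsub>W\<^esub> u) \<and> bruhat_le W (w' \<otimes>\<^bsub>W\<^esub> u) w)"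
proof
  assume "tle (nu (v', w')) (nu (v, w))"
  then obtain v'' w'' u where *: "v'' \<in> carrier W" "w'' \<in> min_reps W K" "nu (v', w') = nu (v'', w'')"
    "u \<in> parabolic W K" "bruhat_le W v (v'' \<otimes>\<^bsub>W\<^esub> u)" "bruhat_le W (w'' \<otimes>\<^bsub>W\<^esub> u) w"
    using below_nu[OF assms(1,2)] by blast
  then show "\<exists>u\<in>parabolic W K. bruhat_le W v (v' \<otimes>\<^bsub>W\<^esub> u) \<and> bruhat_le W (w' \<otimes>\<^bsub>W\<^esub> u) w"
    using nu_inj[OF assms(3,4) *(1-3)] by blast
next
  assume "\<exists>u\<in>parabolic W K. bruhat_le W v (v' \<otimes>\<^bsub>W\<^esub> u) \<and> bruhat_le W (w' \<otimes>\<^bsub>W\<^esub> u) w"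
  then obtain u where u: "u \<in> parabolic W K" "bruhat_le W v (v' \<otimes>\<^bsub>W\<^esub> u)"
    "bruhat_le W (w' \<otimes>\<^bsub>W\<^esub> u) w" by blast
  have c: "u \<in> carrier W" "w' \<in> carrier W"
    using u W.parabolic_closed[OF K] assms min_reps_closed by auto
  have "fl (v' \<otimes>\<^bsub>W\<^esub> u) \<otimes>\<^bsub>V\<^esub> sh (inv\<^bsub>W\<^esub> (w' \<otimes>\<^bsub>W\<^esub> u)) = nu (v', w')"
    using c assms(3) sh_eq_fl[OF u(1)]
    by (simp add: nu_eq W.inv_mult_group sh_mult fl_mult sh_inv V.m_assoc)
  then have "tle (nu (v', w')) (nu (v' \<otimes>\<^bsub>W\<^esub> u, w))"
    using nu_lower[OF _ assms(2) u(3), of "v' \<otimes>\<^bsub>W\<^esub> u"] c assms(3) by simp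
  then show "tle (nu (v', w')) (nu (v, w))"
    using nu_raise[OF u(2) assms(2)] V.twisted_trans[OF flat_part_ix] by blast
qed

section \<open>The three claims\<close>

text \<open>On \<open>Q_set\<close> the middle inequality in \<open>Q_le\<close> follows from
  \<open>v' \<le> w'\<close> by \<open>bruhat_mult_min_reps\<close>; the outer two are those of
  \<open>twisted_nu_iff\<close>.\<close>

lemma Q_le_iff:
  assumes "x \<in> Q_set W K" "y \<in> Q_set W K"
  shows "Q_le W K x y \<longleftrightarrow> tle (nu x) (nu y)"
proof -
  obtain v' w' v w where xy: "x = (v', w')" "y = (v, w)" by (metis surj_pair)
  have "bruhat_le W (v' \<otimes>\<^bsub>W\<^esub> u) (w' \<otimes>\<^bsub>W\<^esub> u)" if "u \<in> parabolic W K" for u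
    using that assms(1) W.bruhat_mult_min_reps[OF K] by (auto simp: xy Q_set_def)
  then show ?thesis
    using assms twisted_nu_iff[of v w v' w'] unfolding xy by (auto simp: Q_set_def Q_le_def)
qed

lemma nu_image_iff:
  assumes "v \<in> carrier W" "w \<in> min_reps W K"
  shows "nu (v, w) \<in> nu ` Q_set W K \<longleftrightarrow> bruhat_le W v w"
  using assms nu_inj by (auto simp: Q_set_def)

lemma nu_iso: "poset_iso (Q_set W K) (Q_le W K) (nu ` Q_set W K) tle nu"
proof -
  have sub: "nu ` Q_set W K \<subseteq> carrier V"
    using nu_closed min_reps_closed by (auto simp: Q_set_def)
  have inj: "inj_on nu (Q_set W K)"
    using nu_inj by (auto simp: inj_on_def Q_set_def)
  have po: "poset_on (nu ` Q_set W K) tle"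
    using V.poset_twisted[OF flat_part_ix] sub unfolding poset_on_def
    by (blast intro: reflp_on_subset transp_on_subset antisymp_on_subset)
  \<comment> \<open>The order axioms are pulled back along the injective map
    \<open>nu\<close>.\<close>
  moreover have "poset_on (Q_set W K) (Q_le W K)"
    unfolding poset_on_def
  proof (intro conjI reflp_onI transp_onI antisymp_onI)
    show "Q_le W K x x" if "x \<in> Q_set W K" for x
      using that po Q_le_iff[of x x] unfolding poset_on_def by (auto dest: reflp_onD)
    show "Q_le W K x z" if "x \<in> Q_set W K" "y \<in> Q_set W K" "z \<in> Q_set W K" "Q_le W K x y" "Q_le W K y z" for x y z
      using that V.twisted_trans[OF flat_part_ix] Q_le_iff by metis
    show "x = y" if "x \<in> Q_set W K" "y \<in> Q_set W K" "Q_le W K x y" "Q_le W K y x" for x y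
      using that V.twisted_antisym[OF flat_part_ix] Q_le_iff inj by (metis inj_onD)
  qed
  ultimately show ?thesis
    unfolding poset_iso_def using inj Q_le_iff by (auto simp: bij_betw_def)
qed

text \<open>If \<open>v \<le> w\<close>, then \<open>r = w\<close> works, since raising
  \<open>v\<close> to \<open>w\<close> goes down in the twisted order. Conversely
  \<open>nu (r, r)\<close> below \<open>nu (v, w)\<close> yields
  \<open>v \<le> r u \<le> w\<close>.\<close>

lemma nu_image:
  "nu ` Q_set W K = {x \<in> parabolic V flat_part <#>\<^bsub>V\<^esub> parabolic V sharp_part.
     \<exists>r\<in>min_reps W K. tle (fl r \<otimes>\<^bsub>V\<^esub> sh (inv\<^bsub>W\<^esub> r)) x}"
  unfolding double_product nu_eq[symmetric]
proof (intro equalityI subsetI)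
  fix x assume "x \<in> nu ` Q_set W K"
  then obtain v w where vw: "v \<in> carrier W" "w \<in> min_reps W K" "bruhat_le W v w" "x = nu (v, w)"
    by (auto simp: Q_set_def)
  have "tle (nu (w, w)) x" unfolding vw(4) by (rule nu_raise[OF vw(3,2)])
  then show "x \<in> {x \<in> nu ` (carrier W \<times> min_reps W K). \<exists>r\<in>min_reps W K. tle (nu (r, r)) x}"
    using vw by blast
next
  fix x assume "x \<in> {x \<in> nu ` (carrier W \<times> min_reps W K). \<exists>r\<in>min_reps W K. tle (nu (r, r)) x}"
  then obtain v w r where vw: "v \<in> carrier W" "w \<in> min_reps W K" "x = nu (v, w)"
    and r: "r \<in> min_reps W K" "tle (nu (r, r)) x" by blast
  then obtain u where "bruhat_le W v (r \<otimes>\<^bsub>W\<^esub> u)" "bruhat_le W (r \<otimes>\<^bsub>W\<^esub> u) w"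
    using twisted_nu_iff[OF vw(1,2) min_reps_closed[OF r(1)] r(1)] by blast
  then have "bruhat_le W v w" using W.bruhat_trans by blast
  then show "x \<in> nu ` Q_set W K" using nu_image_iff vw by blast
qed

text \<open>The upper bound \<open>y\<close> keeps \<open>z\<close> in the product of the two
  subgroups, and the lower bound \<open>x\<close> puts it above some \<open>nu (r, r)\<close>;
  \<open>nu_image\<close> combines the two.\<close>

lemma nu_image_convex: "poset_convex (carrier V) tle (nu ` Q_set W K)"
  unfolding poset_convex_def
proof (intro conjI ballI subsetI)
  show "poset_on (carrier V) tle" by (rule V.poset_twisted[OF flat_part_ix])
  show "x \<in> carrier V" if "x \<in> nu ` Q_set W K" for x
    using that nu_closed min_reps_closed by (auto simp: Q_set_def)
  fix x y z assume x: "x \<in> nu ` Q_set W K" and y: "y \<in> nu ` Q_set W K"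
    and "z \<in> {z \<in> carrier V. tle x z \<and> tle z y}"
  then have z: "tle x z" "tle z y" by auto
  obtain v w where y': "v \<in> carrier W" "w \<in> min_reps W K" "y = nu (v, w)"
    using y by (auto simp: Q_set_def)
  obtain v1 w1 where z': "v1 \<in> carrier W" "w1 \<in> min_reps W K" "z = nu (v1, w1)"
    using below_nu[OF y'(1,2)] z(2) y'(3) by blast
  have "x \<in> parabolic V flat_part <#>\<^bsub>V\<^esub> parabolic V sharp_part \<and>
      (\<exists>r\<in>min_reps W K. tle (fl r \<otimes>\<^bsub>V\<^esub> sh (inv\<^bsub>W\<^esub> r)) x)"
    using x unfolding nu_image by blast
  then have "\<exists>r\<in>min_reps W K. tle (fl r \<otimes>\<^bsub>V\<^esub> sh (inv\<^bsub>W\<^esub> r)) z"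
    using V.twisted_trans[OF flat_part_ix _ z(1)] by blast
  then show "z \<in> nu ` Q_set W K"
    unfolding nu_image double_product using z' by blast
qed

end

theorem proposition4p2:
  fixes W :: "('g, 'i) coxeter" and V :: "('h, 'i + 'i) coxeter" and K :: "'i set"
  assumes "coxeter_system W"
    and "K \<subseteq> simple_ix W"
    and "glued_system W K V"
  shows "poset_iso (Q_set W K) (Q_le W K)
           (nu_map W K V ` Q_set W K) (twisted_le V (flat_ix ` simple_ix W)) (nu_map W K V)
    \<and> nu_map W K V ` Q_set W K =
         {x \<in> parabolic V (flat_ix ` simple_ix W) <#>\<^bsub>V\<^esub> parabolic V (sharp_ix K ` simple_ix W).
            \<exists>r\<in>min_reps W K.
              twisted_le V (flat_ix ` simple_ix W)
                (flat_map W V r \<otimes>\<^bsub>V\<^esub> sharp_map W K V (inv\<^bsub>W\<^esub> r)) x}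
    \<and> poset_convex (carrier V) (twisted_le V (flat_ix ` simple_ix W)) (nu_map W K V ` Q_set W K)"
proof -
  interpret W: coxeter_system W by fact
  interpret V: coxeter_system V using assms(3) by (simp add: glued_system_def)
  interpret glued_coxeter W V K by unfold_locales fact+
  show ?thesis using nu_iso nu_image nu_image_convex by blast
qed

end
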